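(* For every rational $0<s<1$, the set $\{e:\mathcal H^s([T_e])>0\}$ is $\Sigma^0_2$-complete.
   Context: For each $e$, $T_e=\{\sigma\in2^{<\omega}:\forall\tau\subseteq\sigma\ \varphi_{e,|\sigma|}(\tau)\uparrow\}$ is the $e$-th recursive tree, where $\varphi_{e,t}$ denotes the $e$-th partial recursive function run for $t$ steps; $[T]$ denotes the set of infinite paths through $T$. Cantor space $2^\omega$ carries the metric $d(x,y)=2^{-\min\{n:x(n)\ne y(n)\}}$ for $x\ne y$; $\mathcal H^s$ denotes $s$-dimensional Hausdorff measure with respect to this metric. *)

theory Defs
  imports Complex_Main "HOL-Library.Nat_Bijection" "HOL-Library.Extended_Nonnegative_Real"
begin

datatype instr = Inc nat nat | Dec nat nat nat
  (* Inc r j: increment register r, jump to j;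
     Dec r j k: if register r > 0 decrement it and jump to j, else jump to k.
     The machine halts when the program counter leaves the program. *)

type_synonym config = "nat \<times> (nat \<Rightarrow> nat)"

definition decode_instr :: "nat \<Rightarrow> instr" where
  "decode_instr n = (case sum_decode n of
      Inl a \<Rightarrow> Inc (fst (prod_decode a)) (snd (prod_decode a))
    | Inr b \<Rightarrow> Dec (fst (prod_decode b)) (fst (prod_decode (snd (prod_decode b))))
                   (snd (prod_decode (snd (prod_decode b)))))"

text \<open>The e-th program (effective, computable Goedel numbering, onto all programs).\<close>
definition program :: "nat \<Rightarrow> instr list" where
  "program e = map decode_instr (list_decode e)"

definition step :: "instr list \<Rightarrow> config \<Rightarrow> config" where
  "step p c = (case c of (pc, r) \<Rightarrow>
     if pc < length p then
       (case p ! pc of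
          Inc i j \<Rightarrow> (j, r(i := Suc (r i)))
        | Dec i j k \<Rightarrow> (if r i > 0 then (j, r(i := r i - 1)) else (k, r)))
     else (pc, r))"

definition halted :: "instr list \<Rightarrow> config \<Rightarrow> bool" where
  "halted p c = (fst c \<ge> length p)"

definition run :: "nat \<Rightarrow> nat \<Rightarrow> nat \<Rightarrow> config" where
  "run e t x = (step (program e) ^^ t) (0, (\<lambda>_. 0)(0 := x))"

definition conv_within :: "nat \<Rightarrow> nat \<Rightarrow> nat \<Rightarrow> bool" where
  "conv_within e t x = (\<exists>k\<le>t. halted (program e) (run e k x))"

definition computes :: "nat \<Rightarrow> (nat \<Rightarrow> nat) \<Rightarrow> bool" where
  "computes e f = (\<forall>x. \<exists>k. halted (program e) (run e k x) \<and> snd (run e k x) 0 = f x)"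

definition computable :: "(nat \<Rightarrow> nat) \<Rightarrow> bool" where
  "computable f = (\<exists>e. computes e f)"

definition decidable3 :: "(nat \<Rightarrow> nat \<Rightarrow> nat \<Rightarrow> bool) \<Rightarrow> bool" where
  "decidable3 R = computable (\<lambda>m. let (a, bc) = prod_decode m; (b, c) = prod_decode bc
                                   in if R a b c then 1 else 0)"

definition Sigma02 :: "nat set \<Rightarrow> bool" where
  "Sigma02 A = (\<exists>R. decidable3 R \<and> (\<forall>n. n \<in> A \<longleftrightarrow> (\<exists>x. \<forall>y. R n x y)))"

definition many_one_reducible :: "nat set \<Rightarrow> nat set \<Rightarrow> bool" where
  "many_one_reducible B A = (\<exists>f. computable f \<and> (\<forall>n. n \<in> B \<longleftrightarrow> f n \<in> A))"

definition Sigma02_complete :: "nat set \<Rightarrow> bool" where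
  "Sigma02_complete A = (Sigma02 A \<and> (\<forall>B. Sigma02 B \<longrightarrow> many_one_reducible B A))"

text \<open>Bijective coding of binary strings by natural numbers.\<close>
fun str_code :: "bool list \<Rightarrow> nat" where
  "str_code [] = 0"
| "str_code (b # \<tau>) = 2 * str_code \<tau> + (if b then 2 else 1)"

definition rtree :: "nat \<Rightarrow> bool list set" where
  "rtree e = {\<sigma>. \<forall>\<tau> u. \<sigma> = \<tau> @ u \<longrightarrow> \<not> conv_within e (length \<sigma>) (str_code \<tau>)}"

definition paths :: "bool list set \<Rightarrow> (nat \<Rightarrow> bool) set" where
  "paths T = {x. \<forall>n. map x [0..<n] \<in> T}"

definition cantor_dist :: "(nat \<Rightarrow> bool) \<Rightarrow> (nat \<Rightarrow> bool) \<Rightarrow> real" where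
  "cantor_dist x y = (if x = y then 0 else (1/2) ^ (LEAST n. x n \<noteq> y n))"

definition cdiam :: "(nat \<Rightarrow> bool) set \<Rightarrow> real" where
  "cdiam U = (if U = {} then 0 else Sup {cantor_dist x y | x y. x \<in> U \<and> y \<in> U})"

definition hausdorff_cantor :: "real \<Rightarrow> (nat \<Rightarrow> bool) set \<Rightarrow> ennreal" where
  "hausdorff_cantor s A =
     (SUP \<delta>\<in>{0<..}. INF U\<in>{U :: nat \<Rightarrow> (nat \<Rightarrow> bool) set.
                             A \<subseteq> (\<Union>i. U i) \<and> (\<forall>i. cdiam (U i) \<le> \<delta>)}.
         (\<Sum>i. ennreal (cdiam (U i) powr s)))"

end

theory Submission
  imports Defs
begin

text \<open>
  By compactness, \<open>\<H>\<^sup>s([T\<^sub>e]) > 0\<close> iff there is a \<open>c\<close> such that every finite set \<open>F\<close> of strings that,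
  together with the strings found to leave \<open>T\<^sub>e\<close> within \<open>n\<close> steps, covers all strings of length \<open>n\<close>
  satisfies \<open>\<Sum>\<^bsub>\<sigma>\<in>F\<^esub> 2 ^ (- \<lfloor>s |\<sigma>|\<rfloor>) \<ge> 2 ^ (- c)\<close>. Replacing \<open>s |\<sigma>|\<close> by its integer part costs a factor of
  at most 2 and, as \<open>s\<close> is rational, makes the condition decidable; so the set is \<open>\<Sigma>\<^sup>0\<^sub>2\<close>.

  For hardness, let \<open>n \<in> B\<close> iff \<open>\<exists>x. \<forall>y. R n x y\<close>. The tree for \<open>n\<close> loses the string \<open>0\<^sup>x 1 \<rho>\<close> as soon as
  its length exceeds some \<open>y\<close> with \<open>\<not> R n x y\<close>. Thus the part of \<open>[T]\<close> above \<open>0\<^sup>x 1\<close> is the full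
  cylinder, which has positive measure since \<open>s < 1\<close>, or empty, and besides these parts there is only
  the path \<open>0\<^sup>\<omega>\<close>.
\<close>

section \<open>A structured register language\<close>

text \<open>\<open>Dec\<close> is the only test of the machine and it consumes a unit, so
  \<open>LOOP\<close> and \<open>IFD\<close> both decrement the tested register on their nonzero
  branch.\<close>

datatype com = SKIP | INC nat | SEQ com com | LOOP nat com | IFD nat com com

fun clen :: "com \<Rightarrow> nat" where
  "clen SKIP = 0"
| "clen (INC r) = 1"
| "clen (SEQ c d) = clen c + clen d"
| "clen (LOOP r c) = clen c + 3"
| "clen (IFD r c d) = clen c + clen d + 3"

text \<open>The pair \<open>Inc r (Suc a), Dec r j j\<close> at address \<open>a\<close> is an unconditional jump to \<open>j\<close>.\<close>
fun compile :: "nat \<Rightarrow> com \<Rightarrow> instr list" where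
  "compile a SKIP = []"
| "compile a (INC r) = [Inc r (Suc a)]"
| "compile a (SEQ c d) = compile a c @ compile (a + clen c) d"
| "compile a (LOOP r c) = Dec r (a + 1) (a + (clen c + 3)) # compile (a + 1) c
     @ [Inc r (a + (clen c + 2)), Dec r a a]"
| "compile a (IFD r c d) = Dec r (a + 1) (a + (clen c + 3)) # compile (a + 1) c
     @ [Inc r (a + (clen c + 2)), Dec r (a + (clen c + clen d + 3)) (a + (clen c + clen d + 3))]
     @ compile (a + (clen c + 3)) d"

inductive exec :: "com \<Rightarrow> (nat \<Rightarrow> nat) \<Rightarrow> (nat \<Rightarrow> nat) \<Rightarrow> bool" where
  exec_SKIP: "exec SKIP s s"
| exec_INC: "exec (INC r) s (s(r := Suc (s r)))"
| exec_SEQ: "exec c s t \<Longrightarrow> exec d t u \<Longrightarrow> exec (SEQ c d) s u"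
| exec_LOOP0: "s r = 0 \<Longrightarrow> exec (LOOP r c) s s"
| exec_LOOPS: "s r = Suc m \<Longrightarrow> exec c (s(r := m)) t \<Longrightarrow> exec (LOOP r c) t u \<Longrightarrow> exec (LOOP r c) s u"
| exec_IFDS: "s r = Suc m \<Longrightarrow> exec c (s(r := m)) t \<Longrightarrow> exec (IFD r c d) s t"
| exec_IFD0: "s r = 0 \<Longrightarrow> exec d s t \<Longrightarrow> exec (IFD r c d) s t"

lemma length_compile [simp]: "length (compile a c) = clen c"
  by (induction c arbitrary: a) auto

section \<open>Correctness of compilation\<close>

definition reach :: "instr list \<Rightarrow> config \<Rightarrow> config \<Rightarrow> bool" where
  "reach p c c' = (\<exists>k. (step p ^^ k) c = c')"

lemma reach_refl: "reach p c c"
  unfolding reach_def by (rule exI[of _ 0]) simp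

lemma reach_trans: "reach p a b \<Longrightarrow> reach p b c \<Longrightarrow> reach p a c"
  unfolding reach_def by (metis comp_apply funpow_add)

lemma reach_step: "step p c = c' \<Longrightarrow> reach p c c'"
  unfolding reach_def by (rule exI[of _ 1]) simp

lemma step_Inc: "pc < length p \<Longrightarrow> p ! pc = Inc i j \<Longrightarrow> step p (pc, s) = (j, s(i := Suc (s i)))"
  by (simp add: step_def)

lemma step_Dec_Suc:
  "pc < length p \<Longrightarrow> p ! pc = Dec i j k \<Longrightarrow> s i = Suc m \<Longrightarrow> step p (pc, s) = (j, s(i := m))"
  by (simp add: step_def)

lemma step_Dec_0: "pc < length p \<Longrightarrow> p ! pc = Dec i j k \<Longrightarrow> s i = 0 \<Longrightarrow> step p (pc, s) = (k, s)"
  by (simp add: step_def)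

text \<open>The increment makes the following \<open>Dec\<close> take its nonzero branch whatever
  \<open>r\<close> holds, and that \<open>Dec\<close> restores \<open>r\<close>.\<close>

lemma reach_jump:
  assumes "Suc a < length p" "p ! a = Inc r (Suc a)" "p ! Suc a = Dec r j j"
  shows "reach p (a, s) (j, s)"
proof -
  have "step p (a, s) = (Suc a, s(r := Suc (s r)))"
    using assms by (intro step_Inc) auto
  moreover have "step p (Suc a, s(r := Suc (s r))) = (j, (s(r := Suc (s r)))(r := s r))"
    using assms by (intro step_Dec_Suc) auto
  ultimately show ?thesis
    using reach_trans[OF reach_step reach_step] by fastforce
qed

text \<open>Arbitrary surrounding code keeps the claim inductive, since subcommands are compiled at
  shifted addresses inside one and the same program.\<close>

lemma compile_correct:
  "exec c s t \<Longrightarrow> p = pre @ compile (length pre) c @ post \<Longrightarrow>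
    reach p (length pre, s) (length pre + clen c, t)"
proof (induction arbitrary: pre post rule: exec.induct)
  case (exec_SKIP s)
  then show ?case by (simp add: reach_refl)
next
  case (exec_INC r s)
  then show ?case by (intro reach_step) (auto simp: step_Inc nth_append)
next
  case (exec_SEQ c s t d u)
  have "reach p (length pre, s) (length pre + clen c, t)"
    using exec_SEQ.IH(1)[of pre "compile (length pre + clen c) d @ post"] exec_SEQ.prems by simp
  moreover have "reach p (length pre + clen c, t) (length pre + clen c + clen d, u)"
    using exec_SEQ.IH(2)[of "pre @ compile (length pre) c" post] exec_SEQ.prems by simp
  ultimately show ?case
    by (auto intro: reach_trans simp: add.assoc)
next
  case (exec_LOOP0 s r c)
  then show ?case by (intro reach_step) (auto simp: step_Dec_0 nth_append)
next
  case (exec_LOOPS s r m c t u)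
  let ?a = "length pre"
  have p: "p = pre @ Dec r (?a + 1) (?a + (clen c + 3)) # compile (?a + 1) c
     @ [Inc r (?a + (clen c + 2)), Dec r ?a ?a] @ post"
    using exec_LOOPS.prems by simp
  have 1: "reach p (?a, s) (Suc ?a, s(r := m))"
    using exec_LOOPS(1) by (intro reach_step step_Dec_Suc) (auto simp: p nth_append)
  have 2: "reach p (Suc ?a, s(r := m)) (Suc ?a + clen c, t)"
    using exec_LOOPS.IH(1)[of "pre @ [Dec r (?a + 1) (?a + (clen c + 3))]"] p
    by (simp add: fun_upd_def)
  have 3: "reach p (Suc ?a + clen c, t) (?a, t)"
    by (rule reach_jump[of _ _ r]) (auto simp: p nth_append nth_Cons')
  have 4: "reach p (?a, t) (?a + clen (LOOP r c), u)"
    using exec_LOOPS.IH(2) exec_LOOPS.prems by blast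
  show ?case
    using 1 2 3 4 by (blast intro: reach_trans)
next
  case (exec_IFDS s r m c t d)
  let ?a = "length pre"
  have p: "p = pre @ Dec r (?a + 1) (?a + (clen c + 3)) # compile (?a + 1) c
     @ [Inc r (?a + (clen c + 2)), Dec r (?a + (clen c + clen d + 3)) (?a + (clen c + clen d + 3))]
     @ compile (?a + (clen c + 3)) d @ post"
    using exec_IFDS.prems by simp
  have 1: "reach p (?a, s) (Suc ?a, s(r := m))"
    using exec_IFDS(1) by (intro reach_step step_Dec_Suc) (auto simp: p nth_append)
  have 2: "reach p (Suc ?a, s(r := m)) (Suc ?a + clen c, t)"
    using exec_IFDS.IH(1)[of "pre @ [Dec r (?a + 1) (?a + (clen c + 3))]"] p
    by (simp add: fun_upd_def)
  have 3: "reach p (Suc ?a + clen c, t) (?a + (clen c + clen d + 3), t)"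
    by (rule reach_jump[of _ _ r]) (auto simp: p nth_append nth_Cons')
  show ?case
    using 1 2 3 by (auto intro: reach_trans)
next
  case (exec_IFD0 s r d t c)
  let ?a = "length pre"
  let ?pre = "pre @ Dec r (?a + 1) (?a + (clen c + 3)) # compile (?a + 1) c
     @ [Inc r (?a + (clen c + 2)), Dec r (?a + (clen c + clen d + 3)) (?a + (clen c + clen d + 3))]"
  have l: "length ?pre = ?a + (clen c + 3)" by simp
  have p: "p = ?pre @ compile (length ?pre) d @ post"
    using exec_IFD0.prems unfolding l by simp
  have 1: "reach p (?a, s) (?a + (clen c + 3), s)"
    using exec_IFD0(1) by (intro reach_step step_Dec_0) (auto simp: p nth_append)
  have 2: "reach p (?a + (clen c + 3), s) (?a + (clen c + 3) + clen d, t)"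
    using exec_IFD0.IH[OF p] unfolding l .
  show ?case
    using reach_trans[OF 1 2] by (simp add: ac_simps)
qed

text \<open>A loop rule with an invariant: \<open>S k\<close> is the state at the loop test when the
  counter \<open>r\<close> holds \<open>k\<close>.\<close>

lemma exec_LOOP_family:
  assumes "\<And>k. S k r = k" "\<And>k. k < n \<Longrightarrow> exec c ((S (Suc k))(r := k)) (S k)"
  shows "exec (LOOP r c) (S n) (S 0)"
  using assms(2)
proof (induction n)
  case 0
  then show ?case by (simp add: assms(1) exec_LOOP0)
next
  case (Suc n)
  then show ?case
    by (intro exec_LOOPS[of "S (Suc n)" r n c "S n"]) (simp_all add: assms(1) del: fun_upd_apply)
qed

lemma exec_eq: "exec c s t \<Longrightarrow> t = t' \<Longrightarrow> exec c s t'"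
  by simp

lemma exec_INC': "t = s(r := Suc (s r)) \<Longrightarrow> exec (INC r) s t"
  by (simp add: exec_INC)

section \<open>Basic programs: moving, copying, Cantor pairing\<close>

definition MOVE :: "nat \<Rightarrow> nat \<Rightarrow> com" where
  "MOVE a b = LOOP a (INC b)"

lemma exec_MOVE:
  assumes "a \<noteq> b" "t = s(a := 0, b := s b + s a)"
  shows "exec (MOVE a b) s t"
proof -
  have "exec (LOOP a (INC b)) ((\<lambda>k. s(a := k, b := s b + (s a - k))) (s a))
     ((\<lambda>k. s(a := k, b := s b + (s a - k))) 0)"
    by (rule exec_LOOP_family) (use assms(1) in \<open>auto intro!: exec_INC' simp: fun_eq_iff\<close>)
  then show ?thesis
    unfolding MOVE_def assms(2) using assms(1) by (simp add: fun_upd_twist)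
qed

lemma exec_CLEAR: "exec (LOOP a SKIP) s (s(a := 0))"
proof -
  have "exec (LOOP a SKIP) ((\<lambda>k. s(a := k)) (s a)) ((\<lambda>k. s(a := k)) 0)"
    by (rule exec_LOOP_family) (auto intro!: exec_eq[OF exec_SKIP])
  then show ?thesis by simp
qed

definition COPY :: "nat \<Rightarrow> nat \<Rightarrow> nat \<Rightarrow> com" where
  "COPY a b d = SEQ (LOOP a (SEQ (INC b) (INC d))) (MOVE d a)"

lemma exec_COPY:
  assumes "a \<noteq> b" "a \<noteq> d" "b \<noteq> d" "s d = 0" "t = s(b := s b + s a)"
  shows "exec (COPY a b d) s t"
proof -
  let ?S = "\<lambda>k. s(a := k, b := s b + (s a - k), d := s a - k)"
  have "exec (LOOP a (SEQ (INC b) (INC d))) (?S (s a)) (?S 0)"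
    by (rule exec_LOOP_family)
      (use assms(1-3) in \<open>auto intro!: exec_SEQ[OF exec_INC] exec_INC' simp: fun_eq_iff\<close>)
  moreover have "?S (s a) = s"
    using assms by (auto simp: fun_eq_iff)
  moreover have "exec (MOVE d a) (?S 0) t"
    using assms by (intro exec_MOVE) (auto simp: fun_eq_iff)
  ultimately show ?thesis
    unfolding COPY_def by (auto intro: exec_SEQ)
qed

text \<open>\<open>prod_encode (x, y)\<close> is \<open>triangle (x + y) + x\<close>, with
  \<open>x\<close> in \<open>b + 1\<close> and \<open>y\<close> in \<open>b\<close>. The first loop
  leaves \<open>x + y\<close> in \<open>b\<close> and \<open>x\<close> in \<open>b + 2\<close>; the
  second adds \<open>k + 1\<close> to \<open>b + 2\<close> for every
  \<open>k < x + y\<close>.\<close>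

definition PAIR :: "nat \<Rightarrow> com" where
  "PAIR b = SEQ (LOOP (b+1) (SEQ (INC b) (INC (b+2))))
     (SEQ (LOOP b (SEQ (INC (b+2)) (COPY b (b+2) (b+1)))) (MOVE (b+2) b))"

lemma exec_PAIR:
  assumes "\<And>i. i > b + 1 \<Longrightarrow> s i = 0" "t = s(b := prod_encode (s (b+1), s b), b+1 := 0)"
  shows "exec (PAIR b) s t"
proof -
  let ?x = "s (b+1)" and ?y = "s b"
  let ?S = "\<lambda>k. s(b := ?y + (?x - k), b+1 := k, b+2 := ?x - k)"
  have S: "exec (LOOP (b+1) (SEQ (INC b) (INC (b+2)))) (?S ?x) (?S 0)"
    by (rule exec_LOOP_family) (auto intro!: exec_SEQ[OF exec_INC] exec_INC' simp: fun_eq_iff)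
  have S': "?S ?x = s"
    using assms(1) by (auto simp: fun_eq_iff)
  let ?T = "\<lambda>k. s(b := k, b+1 := 0, b+2 := ?x + triangle (?y + ?x) - triangle k)"
  \<comment> \<open>Monotonicity keeps the truncated subtraction in \<open>?T\<close> exact.\<close>
  have le: "triangle k \<le> triangle n" if "k \<le> n" for k n
    using that by (induction n rule: dec_induct) auto
  have T: "exec (LOOP b (SEQ (INC (b+2)) (COPY b (b+2) (b+1)))) (?T (?y+?x)) (?T 0)"
  proof (rule exec_LOOP_family)
    fix k assume "k < ?y + ?x"
    then have "triangle (Suc k) \<le> triangle (?y + ?x)" by (intro le) simp
    then show "exec (SEQ (INC (b+2)) (COPY b (b+2) (b+1))) ((?T (Suc k))(b := k)) (?T k)"
      by (intro exec_SEQ[OF exec_INC] exec_COPY) (auto simp: fun_eq_iff)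
  qed simp
  have T': "?T (?y + ?x) = ?S 0"
    by (auto simp: fun_eq_iff)
  have "exec (MOVE (b+2) b) (?T 0) t"
    using assms by (intro exec_MOVE) (auto simp: fun_eq_iff prod_encode_def ac_simps)
  then show ?thesis
    unfolding PAIR_def using S T unfolding S' T' by (blast intro: exec_SEQ)
qed

text \<open>Decoding as a walk through Cantor's enumeration from \<open>(0, 0)\<close>: each pass
  moves one place along the current diagonal or, if the second component is zero, to the start of
  the next diagonal.\<close>

definition UNPAIR :: "nat \<Rightarrow> com" where
  "UNPAIR b = LOOP b (IFD (b+2) (INC (b+1)) (SEQ (MOVE (b+1) (b+2)) (INC (b+2))))"

definition pfst :: "nat \<Rightarrow> nat" where "pfst n = fst (prod_decode n)"
definition psnd :: "nat \<Rightarrow> nat" where "psnd n = snd (prod_decode n)"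

lemma pfst_pair [simp]: "pfst (prod_encode (a, b)) = a"
  and psnd_pair [simp]: "psnd (prod_encode (a, b)) = b"
  and pair_pfst_psnd [simp]: "prod_encode (pfst n, psnd n) = n"
  by (simp_all add: pfst_def psnd_def)

lemma prod_decode_0: "prod_decode 0 = (0, 0)"
  by (simp add: prod_decode_def prod_decode_aux.simps)

lemma pfst_0 [simp]: "pfst 0 = 0" and psnd_0 [simp]: "psnd 0 = 0"
  by (simp_all add: pfst_def psnd_def prod_decode_0)

lemma pair_Suc_cases:
  "pfst (Suc n) = (if psnd n = 0 then 0 else Suc (pfst n)) \<and>
   psnd (Suc n) = (if psnd n = 0 then Suc (pfst n) else psnd n - 1)"
proof -
  let ?p = "(if psnd n = 0 then 0 else Suc (pfst n), if psnd n = 0 then Suc (pfst n) else psnd n - 1)"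
  have "prod_encode ?p = Suc (prod_encode (pfst n, psnd n))"
    by (auto simp: prod_encode_def gr0_conv_Suc)
  then have "prod_decode (Suc n) = ?p"
    by (metis pair_pfst_psnd prod_encode_inverse)
  then show ?thesis by (simp add: pfst_def psnd_def)
qed

lemma exec_UNPAIR:
  assumes "\<And>i. i > b \<Longrightarrow> s i = 0" "t = s(b := 0, b+1 := pfst (s b), b+2 := psnd (s b))"
  shows "exec (UNPAIR b) s t"
proof -
  let ?S = "\<lambda>k. s(b := k, b+1 := pfst (s b - k), b+2 := psnd (s b - k))"
  let ?c = "IFD (b+2) (INC (b+1)) (SEQ (MOVE (b+1) (b+2)) (INC (b+2)))"
  have "exec (LOOP b ?c) (?S (s b)) (?S 0)"
  proof (rule exec_LOOP_family)
    fix k assume k: "k < s b"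
    define m where "m = s b - Suc k"
    have m: "s b - k = Suc m" "s b - Suc k = m" using k by (auto simp: m_def)
    show "exec ?c ((?S (Suc k))(b := k)) (?S k)"
    proof (cases "psnd m")
      case 0
      then show ?thesis unfolding m
        by (intro exec_IFD0 exec_SEQ[OF exec_MOVE[OF _ refl] exec_INC'])
          (auto simp: fun_eq_iff pair_Suc_cases)
    next
      case (Suc j)
      then show ?thesis unfolding m
        by (intro exec_IFDS[of _ _ j] exec_INC') (auto simp: fun_eq_iff pair_Suc_cases)
    qed
  qed simp
  moreover have "?S (s b) = s"
    using assms(1) by (auto simp: fun_eq_iff)
  ultimately show ?thesis
    by (simp add: assms(2) UNPAIR_def)
qed

section \<open>A class of total computable functions\<close>

text \<open>The parameter \<open>b\<close> makes the code relocatable: input and output are in register \<open>b\<close>, the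
  registers above \<open>b\<close> are scratch space, and those below are left alone.\<close>
definition cf :: "(nat \<Rightarrow> nat) \<Rightarrow> bool" where
  "cf f = (\<exists>C. \<forall>b s. (\<forall>i>b. s i = 0) \<longrightarrow> exec (C b) s (s(b := f (s b))))"

lemma cfI: "(\<And>b s. (\<And>i. i > b \<Longrightarrow> s i = 0) \<Longrightarrow> exec (C b) s (s(b := f (s b)))) \<Longrightarrow> cf f"
  unfolding cf_def by blast

lemma cfE:
  assumes "cf f"
  obtains C where "\<And>b s t. (\<And>i. i > b \<Longrightarrow> s i = 0) \<Longrightarrow> t = s(b := f (s b)) \<Longrightarrow> exec (C b) s t"
  using assms unfolding cf_def by blast

named_theorems cf_intros

lemma cf_id [cf_intros]: "cf (\<lambda>x. x)"
  by (rule cfI[of "\<lambda>b. SKIP"]) (simp add: exec_SKIP)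

lemma cf_comp: "cf f \<Longrightarrow> cf g \<Longrightarrow> cf (\<lambda>x. f (g x))"
proof (elim cfE)
  fix C D
  assume C: "\<And>b s t. (\<And>i. i > b \<Longrightarrow> s i = 0) \<Longrightarrow> t = s(b := f (s b)) \<Longrightarrow> exec (C b) s t"
    and D: "\<And>b s t. (\<And>i. i > b \<Longrightarrow> s i = 0) \<Longrightarrow> t = s(b := g (s b)) \<Longrightarrow> exec (D b) s t"
  show ?thesis
    by (rule cfI[of "\<lambda>b. SEQ (D b) (C b)"]) (auto intro!: exec_SEQ[OF D[OF _ refl] C])
qed

lemma cf_const_0: "cf (\<lambda>x. 0)"
  by (rule cfI[of "\<lambda>b. LOOP b SKIP"]) (simp add: exec_CLEAR)

lemma cf_Suc [cf_intros]: "cf f \<Longrightarrow> cf (\<lambda>x. Suc (f x))"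
proof (rule cf_comp[of Suc])
  show "cf Suc" by (rule cfI[of "\<lambda>b. INC b"]) (simp add: exec_INC)
qed

lemma cf_const [cf_intros]: "cf (\<lambda>x. c)"
  by (induction c) (auto intro: cf_const_0 cf_Suc)

lemma cf_pfst [cf_intros]: "cf f \<Longrightarrow> cf (\<lambda>x. pfst (f x))"
proof (rule cf_comp[of pfst])
  show "cf pfst"
    by (rule cfI[of "\<lambda>b. SEQ (UNPAIR b) (SEQ (MOVE (b+1) b) (LOOP (b+2) SKIP))"])
      (rule exec_SEQ[OF exec_UNPAIR[OF _ refl] exec_SEQ[OF exec_MOVE[OF _ refl] exec_eq[OF exec_CLEAR]]];
       auto simp: fun_eq_iff)
qed

lemma cf_psnd [cf_intros]: "cf f \<Longrightarrow> cf (\<lambda>x. psnd (f x))"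
proof (rule cf_comp[of psnd])
  show "cf psnd"
    by (rule cfI[of "\<lambda>b. SEQ (UNPAIR b) (SEQ (MOVE (b+2) b) (LOOP (b+1) SKIP))"])
      (rule exec_SEQ[OF exec_UNPAIR[OF _ refl] exec_SEQ[OF exec_MOVE[OF _ refl] exec_eq[OF exec_CLEAR]]];
       auto simp: fun_eq_iff)
qed

lemma cf_pair [cf_intros]: "cf f \<Longrightarrow> cf g \<Longrightarrow> cf (\<lambda>x. prod_encode (f x, g x))"
proof (elim cfE)
  fix C D
  assume C: "\<And>b s t. (\<And>i. i > b \<Longrightarrow> s i = 0) \<Longrightarrow> t = s(b := f (s b)) \<Longrightarrow> exec (C b) s t"
    and D: "\<And>b s t. (\<And>i. i > b \<Longrightarrow> s i = 0) \<Longrightarrow> t = s(b := g (s b)) \<Longrightarrow> exec (D b) s t"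
  show ?thesis
  \<comment> \<open>Both codes run at base \<open>b + 1\<close>, with the value to be preserved safe
    in \<open>b\<close>. \<open>PAIR\<close> expects the second component in \<open>b\<close>, hence
    \<open>g\<close> is evaluated first.\<close>
  proof (rule cfI[of "\<lambda>b. SEQ (COPY b (b+1) (b+2)) (SEQ (D (b+1)) (SEQ (MOVE b (b+2))
      (SEQ (MOVE (b+1) b) (SEQ (MOVE (b+2) (b+1)) (SEQ (C (b+1)) (PAIR b))))))"])
    fix b and s :: "nat \<Rightarrow> nat"
    assume z: "\<And>i. i > b \<Longrightarrow> s i = 0"
    let ?x = "s b"
    have "exec (COPY b (b+1) (b+2)) s (s(b+1 := ?x))"
      using z by (intro exec_COPY) auto
    moreover have "exec (D (b+1)) (s(b+1 := ?x)) (s(b+1 := g ?x))"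
      using z by (intro D) auto
    moreover have "exec (MOVE b (b+2)) (s(b+1 := g ?x)) (s(b := 0, b+1 := g ?x, b+2 := ?x))"
      using z by (intro exec_MOVE) (auto simp: fun_eq_iff)
    moreover have "exec (MOVE (b+1) b) (s(b := 0, b+1 := g ?x, b+2 := ?x)) (s(b := g ?x, b+2 := ?x))"
      using z by (intro exec_MOVE) (auto simp: fun_eq_iff)
    moreover have "exec (MOVE (b+2) (b+1)) (s(b := g ?x, b+2 := ?x)) (s(b := g ?x, b+1 := ?x))"
      using z by (intro exec_MOVE) (auto simp: fun_eq_iff)
    moreover have "exec (C (b+1)) (s(b := g ?x, b+1 := ?x)) (s(b := g ?x, b+1 := f ?x))"
      using z by (intro C) (auto simp: fun_eq_iff)
    moreover have "exec (PAIR b) (s(b := g ?x, b+1 := f ?x)) (s(b := prod_encode (f ?x, g ?x)))"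
      using z by (intro exec_PAIR) (auto simp: fun_eq_iff)
    ultimately show "exec (SEQ (COPY b (b+1) (b+2)) (SEQ (D (b+1)) (SEQ (MOVE b (b+2))
      (SEQ (MOVE (b+1) b) (SEQ (MOVE (b+2) (b+1)) (SEQ (C (b+1)) (PAIR b)))))))
      s (s(b := prod_encode (f ?x, g ?x)))"
      by (blast intro: exec_SEQ)
  qed
qed

lemma cf_iter: "cf f \<Longrightarrow> cf (\<lambda>x. (f ^^ pfst x) (psnd x))"
proof (elim cfE)
  fix C
  assume C: "\<And>b s t. (\<And>i. i > b \<Longrightarrow> s i = 0) \<Longrightarrow> t = s(b := f (s b)) \<Longrightarrow> exec (C b) s t"
  show ?thesis
  proof (rule cfI[of "\<lambda>b. SEQ (UNPAIR b) (SEQ (MOVE (b+1) b) (SEQ (MOVE (b+2) (b+1))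
      (SEQ (LOOP b (C (b+1))) (MOVE (b+1) b))))"])
    fix b and s :: "nat \<Rightarrow> nat"
    assume z: "\<And>i. i > b \<Longrightarrow> s i = 0"
    let ?n = "pfst (s b)" and ?y = "psnd (s b)"
    let ?S = "\<lambda>k. s(b := k, b+1 := (f ^^ (?n - k)) ?y)"
    have "exec (UNPAIR b) s (s(b := 0, b+1 := ?n, b+2 := ?y))"
      using z by (intro exec_UNPAIR) auto
    moreover have "exec (MOVE (b+1) b) (s(b := 0, b+1 := ?n, b+2 := ?y)) (s(b := ?n, b+2 := ?y))"
      using z by (intro exec_MOVE) (auto simp: fun_eq_iff)
    moreover have "exec (MOVE (b+2) (b+1)) (s(b := ?n, b+2 := ?y)) (s(b := ?n, b+1 := ?y))"
      using z by (intro exec_MOVE) (auto simp: fun_eq_iff)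
    moreover have "exec (LOOP b (C (b+1))) (s(b := ?n, b+1 := ?y)) (s(b := 0, b+1 := (f ^^ ?n) ?y))"
    proof -
      have "exec (LOOP b (C (b+1))) (?S ?n) (?S 0)"
      proof (rule exec_LOOP_family)
        fix k assume "k < ?n"
        then have "?n - k = Suc (?n - Suc k)" by simp
        then show "exec (C (b+1)) ((?S (Suc k))(b := k)) (?S k)"
          using z by (intro C) (auto simp: fun_eq_iff)
      qed simp
      then show ?thesis by simp
    qed
    moreover have "exec (MOVE (b+1) b) (s(b := 0, b+1 := (f ^^ ?n) ?y)) (s(b := (f ^^ ?n) ?y))"
      using z by (intro exec_MOVE) (auto simp: fun_eq_iff)
    ultimately show "exec (SEQ (UNPAIR b) (SEQ (MOVE (b+1) b) (SEQ (MOVE (b+2) (b+1))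
      (SEQ (LOOP b (C (b+1))) (MOVE (b+1) b))))) s (s(b := (f ^^ ?n) ?y))"
      by (blast intro: exec_SEQ)
  qed
qed

text \<open>Primitive recursion is iteration on coded triples of parameter, counter and
  value.\<close>

lemma cf_rec [cf_intros]:
  assumes "cf n" "cf g" "cf (\<lambda>z. h (pfst z) (pfst (psnd z)) (psnd (psnd z)))"
  shows "cf (\<lambda>x. rec_nat (g x) (h x) (n x))"
proof -
  define F where "F = (\<lambda>z. prod_encode (pfst z, prod_encode (Suc (pfst (psnd z)),
     h (pfst z) (pfst (psnd z)) (psnd (psnd z)))))"
  have F: "cf F"
    unfolding F_def by (intro cf_intros assms)
  have iter: "(F ^^ k) (prod_encode (x, prod_encode (0, a))) =
      prod_encode (x, prod_encode (k, rec_nat a (h x) k))" for k x a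
    by (induction k) (simp_all add: F_def)
  have "cf (\<lambda>x. (F ^^ pfst (prod_encode (n x, prod_encode (x, prod_encode (0, g x)))))
     (psnd (prod_encode (n x, prod_encode (x, prod_encode (0, g x))))))"
    by (rule cf_comp[OF cf_iter[OF F]]) (intro cf_intros assms)
  then have "cf (\<lambda>x. prod_encode (x, prod_encode (n x, rec_nat (g x) (h x) (n x))))"
    by (simp add: iter)
  from cf_psnd[OF cf_psnd[OF this]] show ?thesis by simp
qed

lemma cf_comp2:
  "cf (\<lambda>z. F (pfst z) (psnd z)) \<Longrightarrow> cf f \<Longrightarrow> cf g \<Longrightarrow> cf (\<lambda>x. F (f x) (g x))"
  using cf_comp[OF _ cf_pair, of "\<lambda>z. F (pfst z) (psnd z)" f g] by simp

lemma cf_funpow [cf_intros]: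
  assumes "cf n" "cf g" "cf (\<lambda>z. f (pfst z) (psnd z))"
  shows "cf (\<lambda>x. (f x ^^ n x) (g x))"
proof -
  have "rec_nat a (\<lambda>_. f x) k = (f x ^^ k) a" for x k a
    by (induction k) simp_all
  moreover have "cf (\<lambda>x. rec_nat (g x) (\<lambda>_. f x) (n x))"
    by (intro cf_intros assms cf_comp2[OF assms(3)])
  ultimately show ?thesis by simp
qed

section \<open>Arithmetic functions\<close>

lemma cf_add [cf_intros]: "cf f \<Longrightarrow> cf g \<Longrightarrow> cf (\<lambda>x. f x + g x)"
proof -
  have "rec_nat a (\<lambda>_ v. Suc v) b = a + b" for a b :: nat
    by (induction b) simp_all
  moreover assume "cf f" "cf g"
  then have "cf (\<lambda>x. rec_nat (f x) (\<lambda>_ v. Suc v) (g x))"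
    by (intro cf_intros)
  ultimately show ?thesis by simp
qed

lemma cf_pred: "cf f \<Longrightarrow> cf (\<lambda>x. f x - 1)"
proof -
  have "rec_nat 0 (\<lambda>k _. k) a = a - 1" for a :: nat
    by (cases a) simp_all
  moreover assume "cf f"
  then have "cf (\<lambda>x. rec_nat 0 (\<lambda>k _. k) (f x))"
    by (intro cf_intros)
  ultimately show ?thesis by simp
qed

lemma cf_diff [cf_intros]: "cf f \<Longrightarrow> cf g \<Longrightarrow> cf (\<lambda>x. f x - g x)"
proof -
  have "rec_nat a (\<lambda>_ v. v - 1) b = a - b" for a b :: nat
    by (induction b) simp_all
  moreover assume "cf f" "cf g"
  then have "cf (\<lambda>x. rec_nat (f x) (\<lambda>_ v. v - 1) (g x))"
    by (intro cf_intros cf_pred)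
  ultimately show ?thesis by simp
qed

lemma cf_mult [cf_intros]: "cf f \<Longrightarrow> cf g \<Longrightarrow> cf (\<lambda>x. f x * g x)"
proof -
  assume fg: "cf f" "cf g"
  have "rec_nat 0 (\<lambda>_ v. v + a) b = a * b" for a b :: nat
    by (induction b) simp_all
  moreover have "cf (\<lambda>x. rec_nat 0 (\<lambda>_ v. v + f x) (g x))"
    by (intro cf_intros cf_comp[OF fg(1)] fg)
  ultimately show ?thesis by simp
qed

lemma cf_power [cf_intros]: "cf f \<Longrightarrow> cf g \<Longrightarrow> cf (\<lambda>x. f x ^ g x)"
proof -
  assume fg: "cf f" "cf g"
  have "rec_nat 1 (\<lambda>_ v. v * a) b = a ^ b" for a b :: nat
    by (induction b) simp_all
  moreover have "cf (\<lambda>x. rec_nat 1 (\<lambda>_ v. v * f x) (g x))"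
    by (intro cf_intros cf_comp[OF fg(1)] fg)
  ultimately show ?thesis by simp
qed

lemma cf_sum [cf_intros]:
  assumes "cf n" "cf (\<lambda>z. F (pfst z) (psnd z))"
  shows "cf (\<lambda>x. \<Sum>i<n x. F x i)"
proof -
  have "rec_nat 0 (\<lambda>i v. v + F x i) k = (\<Sum>i<k. F x i)" for k x
    by (induction k) simp_all
  moreover have "cf (\<lambda>x. rec_nat 0 (\<lambda>i v. v + F x i) (n x))"
    using assms by (intro cf_intros cf_comp2[OF assms(2)])
  ultimately show ?thesis by simp
qed

section \<open>Decidable predicates\<close>

definition dec :: "(nat \<Rightarrow> bool) \<Rightarrow> bool" where
  "dec P = cf (\<lambda>x. if P x then 1 else 0)"

lemma dec_comp: "dec P \<Longrightarrow> cf f \<Longrightarrow> dec (\<lambda>x. P (f x))"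
  unfolding dec_def by (rule cf_comp)

lemma cf_if [cf_intros]: "dec P \<Longrightarrow> cf f \<Longrightarrow> cf g \<Longrightarrow> cf (\<lambda>x. if P x then f x else g x)"
proof -
  assume a: "dec P" "cf f" "cf g"
  have "cf (\<lambda>x. rec_nat (g x) (\<lambda>_ _. f x) (if P x then 1 else 0))"
    by (intro cf_intros a cf_comp[OF a(2)] a(1)[unfolded dec_def])
  moreover have "rec_nat (g x) (\<lambda>_ _. f x) (if P x then 1 else 0) = (if P x then f x else g x)" for x
    by simp
  ultimately show ?thesis by simp
qed

lemma dec_eq_0: "cf f \<Longrightarrow> dec (\<lambda>x. f x = 0)"
proof -
  assume "cf f"
  then have "cf (\<lambda>x. 1 - f x)" by (intro cf_intros)
  moreover have "1 - f x = (if f x = 0 then 1 else 0)" for x by simp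
  ultimately show ?thesis by (simp add: dec_def)
qed

lemma dec_not [cf_intros]: "dec P \<Longrightarrow> dec (\<lambda>x. \<not> P x)"
proof -
  assume "dec P"
  then have "dec (\<lambda>x. (if P x then 1 else 0) = (0 :: nat))"
    by (intro dec_eq_0) (simp add: dec_def)
  moreover have "(if P x then 1 else 0) = (0 :: nat) \<longleftrightarrow> \<not> P x" for x by simp
  ultimately show ?thesis by (simp only:)
qed

lemma dec_conj [cf_intros]: "dec P \<Longrightarrow> dec Q \<Longrightarrow> dec (\<lambda>x. P x \<and> Q x)"
proof -
  assume "dec P" "dec Q"
  then have "cf (\<lambda>x. if P x then if Q x then 1 else 0 else 0)" by (intro cf_intros)
  moreover have "(if P x then if Q x then 1 else 0 else 0) = (if P x \<and> Q x then 1 else (0::nat))" for x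
    by simp
  ultimately show ?thesis by (simp add: dec_def)
qed

lemma dec_disj [cf_intros]: "dec P \<Longrightarrow> dec Q \<Longrightarrow> dec (\<lambda>x. P x \<or> Q x)"
  using dec_not[OF dec_conj[OF dec_not dec_not], of P Q] by simp

lemma dec_imp [cf_intros]: "dec P \<Longrightarrow> dec Q \<Longrightarrow> dec (\<lambda>x. P x \<longrightarrow> Q x)"
  using dec_disj[OF dec_not, of P Q] by simp

lemma dec_le [cf_intros]: "cf f \<Longrightarrow> cf g \<Longrightarrow> dec (\<lambda>x. f x \<le> g x)"
  using dec_eq_0[OF cf_diff, of f g] by simp

lemma dec_less [cf_intros]: "cf f \<Longrightarrow> cf g \<Longrightarrow> dec (\<lambda>x. f x < g x)"
  using dec_le[OF cf_Suc, of f g] by (simp add: Suc_le_eq)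

lemma dec_eq [cf_intros]: "cf f \<Longrightarrow> cf g \<Longrightarrow> dec (\<lambda>x. f x = g x)"
  using dec_conj[OF dec_le dec_le, of f g g f] by (simp add: order_eq_iff)

lemma dec_all [cf_intros]:
  assumes "cf n" "dec (\<lambda>z. P (pfst z) (psnd z))"
  shows "dec (\<lambda>x. \<forall>i<n x. P x i)"
proof -
  have "dec (\<lambda>x. (\<Sum>i<n x. if P x i then 0 else 1) = (0::nat))"
    by (intro cf_intros assms)
  moreover have "(\<Sum>i<n x. if P x i then 0 else 1) = (0::nat) \<longleftrightarrow> (\<forall>i<n x. P x i)" for x
    by auto
  ultimately show ?thesis by simp
qed

lemma dec_ex [cf_intros]:
  assumes "cf n" "dec (\<lambda>z. P (pfst z) (psnd z))"
  shows "dec (\<lambda>x. \<exists>i<n x. P x i)"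
proof -
  have "dec (\<lambda>x. \<not> (\<forall>i<n x. \<not> P x i))"
    by (intro cf_intros assms)
  then show ?thesis by simp
qed

text \<open>The quotient counts the positive multiples of the divisor up to the dividend. Divisor
  zero is a separate case: the count would be \<open>a\<close>, whereas
  \<open>a div 0 = 0\<close>.\<close>

lemma cf_div [cf_intros]: "cf f \<Longrightarrow> cf g \<Longrightarrow> cf (\<lambda>x. f x div g x)"
proof -
  assume fg: "cf f" "cf g"
  have "(if b = 0 then 0 else \<Sum>i<a. if Suc i * b \<le> a then 1 else 0) = a div b" for a b :: nat
  proof (cases "b = 0")
    case False
    have "(\<Sum>i<a. if Suc i * b \<le> a then 1 else 0) = card {i. i < a \<and> Suc i * b \<le> a}"
      by (simp add: sum.If_cases Int_def)
    also have "{i. i < a \<and> Suc i * b \<le> a} = {..< a div b}"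
    proof -
      have "i < a \<and> Suc i * b \<le> a \<longleftrightarrow> i < a div b" for i
        using False by (metis Suc_le_eq div_le_dividend less_eq_div_iff_mult_less_eq neq0_conv order_less_le_trans)
      then show ?thesis by auto
    qed
    finally show ?thesis using False by simp
  qed simp
  note * = this
  have "cf (\<lambda>x. if g x = 0 then 0 else \<Sum>i<f x. if Suc i * g x \<le> f x then 1 else 0)"
    by (intro cf_intros cf_comp[OF fg(1)] cf_comp[OF fg(2)])
  then show ?thesis unfolding * .
qed

lemma cf_mod [cf_intros]: "cf f \<Longrightarrow> cf g \<Longrightarrow> cf (\<lambda>x. f x mod g x)"
proof -
  assume "cf f" "cf g"
  then have "cf (\<lambda>x. f x - f x div g x * g x)" by (intro cf_intros)
  then show ?thesis by (simp add: minus_div_mult_eq_mod)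
qed

section \<open>A universal simulator\<close>

text \<open>Since \<open>prod_decode 0 = (0, 0)\<close>, iterated pairing codes every finitely supported sequence.\<close>
definition rd :: "nat \<Rightarrow> nat \<Rightarrow> nat" where
  "rd c i = pfst ((psnd ^^ i) c)"

text \<open>Primitive recursion rebuilds the code from the inside: the tail beyond \<open>i\<close>
  with \<open>v\<close> in front, then the old entries \<open>i - 1\<close>, ..., \<open>0\<close>
  prepended in turn.\<close>

definition upd :: "nat \<Rightarrow> nat \<Rightarrow> nat \<Rightarrow> nat" where
  "upd c i v = rec_nat (prod_encode (v, (psnd ^^ Suc i) c))
     (\<lambda>k a. prod_encode (rd c (i - Suc k), a)) i"

lemma cf_rd [cf_intros]: "cf f \<Longrightarrow> cf g \<Longrightarrow> cf (\<lambda>x. rd (f x) (g x))"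
  unfolding rd_def by (intro cf_intros)

lemma cf_upd [cf_intros]:
  assumes "cf f" "cf g" "cf h"
  shows "cf (\<lambda>x. upd (f x) (g x) (h x))"
  unfolding upd_def by (intro cf_intros cf_comp[OF assms(1)] cf_comp[OF assms(2)] assms)

lemma rd_0: "rd 0 i = 0"
proof -
  have "(psnd ^^ i) 0 = 0" by (induction i) simp_all
  then show ?thesis by (simp add: rd_def)
qed

lemma rd_pair: "rd (prod_encode (a, c)) i = (if i = 0 then a else rd c (i - 1))"
  by (cases i) (simp_all add: rd_def funpow_swap1)

lemma rd_upd: "rd (upd c i v) = (rd c)(i := v)"
proof -
  \<comment> \<open>After \<open>k\<close> rounds the result is the sequence from position
    \<open>i - k\<close> on, so the new value sits at index \<open>k\<close>.\<close>
  have *: "k \<le> i \<Longrightarrow> rd (rec_nat (prod_encode (v, (psnd ^^ Suc i) c))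
     (\<lambda>k a. prod_encode (rd c (i - Suc k), a)) k) j = (if j = k then v else rd c (i - k + j))" for k j
  proof (induction k arbitrary: j)
    case 0
    show ?case
    proof (cases j)
      case (Suc m)
      have "(psnd ^^ (Suc i + m)) c = (psnd ^^ m) ((psnd ^^ Suc i) c)"
        by (metis add.commute comp_apply funpow_add)
      then show ?thesis using Suc by (simp add: rd_pair) (simp add: rd_def)
    qed (simp add: rd_pair)
  next
    case (Suc k)
    then show ?case
      by (auto simp: rd_pair intro!: arg_cong[of _ _ "rd c"])
  qed
  show ?thesis
    unfolding upd_def fun_eq_iff *[OF order_refl] by simp
qed

text \<open>With this, a number quantifier can range over all finite sets of strings.\<close>

lemma ex_rd: "finite F \<Longrightarrow> \<exists>y. \<forall>i. rd y i \<noteq> 0 \<longleftrightarrow> i \<in> F"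
proof (induction rule: finite_induct)
  case empty
  then show ?case by (intro exI[of _ 0]) (simp add: rd_0)
next
  case (insert i F)
  then obtain y where "\<forall>i. rd y i \<noteq> 0 \<longleftrightarrow> i \<in> F" by blast
  then show ?case by (intro exI[of _ "upd y i 1"]) (auto simp: rd_upd)
qed

text \<open>The tail on list codes, where \<open>0\<close> codes the empty list; as
  \<open>psnd 0 = 0\<close>, the empty list is its own tail.\<close>

definition tlc :: "nat \<Rightarrow> nat" where "tlc e = psnd (e - 1)"

lemma cf_tlc [cf_intros]: "cf f \<Longrightarrow> cf (\<lambda>x. tlc (f x))"
  unfolding tlc_def by (intro cf_intros)

lemma list_decode_tlc: "list_decode ((tlc ^^ k) e) = drop k (list_decode e)"
proof (induction k)
  case (Suc k)
  have "list_decode (tlc m) = tl (list_decode m)" for m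
    by (cases m) (simp_all add: tlc_def psnd_def prod_decode_0 split: prod.split)
  then show ?case by (simp add: Suc drop_Suc drop_tl)
qed simp

lemma tlc_eq_0_iff: "(tlc ^^ k) e = 0 \<longleftrightarrow> length (program e) \<le> k"
proof -
  have "(tlc ^^ k) e = 0 \<longleftrightarrow> list_decode ((tlc ^^ k) e) = []"
    by (metis list_decode.simps(1) list_decode_inverse list_encode.simps(1))
  then show ?thesis by (simp add: list_decode_tlc program_def)
qed

lemma program_nth:
  assumes "k < length (program e)"
  shows "program e ! k = decode_instr (pfst ((tlc ^^ k) e - 1))"
proof -
  obtain m where m: "(tlc ^^ k) e = Suc m"
    using assms tlc_eq_0_iff[of k e] by (cases "(tlc ^^ k) e") auto
  have "list_decode (Suc m) ! 0 = list_decode e ! k"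
    using assms list_decode_tlc[of k e] by (simp add: m program_def)
  then show ?thesis
    using assms by (simp add: m program_def pfst_def split: prod.splits)
qed

text \<open>A configuration is coded as the pair of program counter and register sequence. The
  parity of an instruction code is the tag read by \<open>sum_decode\<close>: even for
  \<open>Inc\<close>, odd for \<open>Dec\<close>.\<close>

definition stepc :: "nat \<Rightarrow> nat \<Rightarrow> nat" where
  "stepc e z = (if (tlc ^^ pfst z) e = 0 then z
     else let i = pfst ((tlc ^^ pfst z) e - 1); a = i div 2; s = psnd z; r = pfst a in
       if i mod 2 = 0 then prod_encode (psnd a, upd s r (Suc (rd s r)))
       else if rd s r = 0 then prod_encode (psnd (psnd a), s)
       else prod_encode (pfst (psnd a), upd s r (rd s r - 1)))"

definition absc :: "nat \<Rightarrow> config" where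
  "absc z = (pfst z, rd (psnd z))"

lemma absc_stepc: "absc (stepc e z) = step (program e) (absc z)"
proof (cases "(tlc ^^ pfst z) e = 0")
  case True
  then show ?thesis
    using tlc_eq_0_iff[of "pfst z" e] by (simp add: stepc_def absc_def step_def)
next
  case False
  then have l: "pfst z < length (program e)"
    using tlc_eq_0_iff[of "pfst z" e] by simp
  then show ?thesis using False
    by (auto simp: stepc_def absc_def step_def program_nth Let_def decode_instr_def sum_decode_def
        rd_upd pfst_def[symmetric] psnd_def[symmetric] split: sum.split)
qed

lemma cf_stepc [cf_intros]: "cf f \<Longrightarrow> cf g \<Longrightarrow> cf (\<lambda>x. stepc (f x) (g x))"
  unfolding stepc_def Let_def by (intro cf_intros)

definition runc :: "nat \<Rightarrow> nat \<Rightarrow> nat \<Rightarrow> nat" where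
  "runc e t x = (stepc e ^^ t) (prod_encode (0, prod_encode (x, 0)))"

lemma absc_runc: "absc (runc e t x) = run e t x"
proof (induction t)
  case 0
  show ?case by (auto simp: runc_def run_def absc_def rd_pair rd_0)
next
  case (Suc t)
  then show ?case by (simp add: runc_def run_def absc_stepc)
qed

lemma cf_runc [cf_intros]:
  assumes "cf f" "cf g" "cf h"
  shows "cf (\<lambda>x. runc (f x) (g x) (h x))"
  unfolding runc_def by (intro cf_intros cf_comp[OF assms(1)] assms)

lemma halted_runc: "halted (program e) (run e t x) \<longleftrightarrow> (tlc ^^ pfst (runc e t x)) e = 0"
  by (simp add: absc_runc[symmetric] halted_def absc_def tlc_eq_0_iff)

lemma dec_halted [cf_intros]:
  "cf f \<Longrightarrow> cf g \<Longrightarrow> cf h \<Longrightarrow> dec (\<lambda>x. halted (program (f x)) (run (f x) (g x) (h x)))"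
  unfolding halted_runc by (intro cf_intros)

lemma cf_run_output [cf_intros]:
  "cf f \<Longrightarrow> cf g \<Longrightarrow> cf h \<Longrightarrow> cf (\<lambda>x. snd (run (f x) (g x) (h x)) 0)"
  unfolding absc_runc[symmetric] absc_def by (simp, intro cf_intros)

lemma run_halted:
  assumes "halted (program e) (run e k x)" "k \<le> t"
  shows "run e t x = run e k x"
  using assms(2)
proof (induction t rule: dec_induct)
  case (step t)
  then show ?case
    using assms(1) by (auto simp: run_def halted_def Defs.step_def split: prod.splits)
qed simp

text \<open>A halted configuration never changes, so looking at step \<open>t\<close> replaces the
  search through all earlier steps.\<close>

lemma conv_within_iff: "conv_within e t x \<longleftrightarrow> halted (program e) (run e t x)"
  unfolding conv_within_def by (metis run_halted order_refl)

lemma dec_conv_within [cf_intros]: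
  "cf f \<Longrightarrow> cf g \<Longrightarrow> cf h \<Longrightarrow> dec (\<lambda>x. conv_within (f x) (g x) (h x))"
  unfolding conv_within_iff by (intro cf_intros)

section \<open>Encoding compiled programs\<close>

fun enc_instr :: "instr \<Rightarrow> nat" where
  "enc_instr (Inc i j) = 2 * prod_encode (i, j)"
| "enc_instr (Dec i j k) = Suc (2 * prod_encode (i, prod_encode (j, k)))"

lemma decode_enc_instr [simp]: "decode_instr (enc_instr i) = i"
  by (cases i) (auto simp: decode_instr_def sum_decode_def)

text \<open>The argument \<open>l\<close> is the code of the instructions that follow, so that
  concatenation of programs becomes composition.\<close>

definition enc_app :: "instr list \<Rightarrow> nat \<Rightarrow> nat" where
  "enc_app p l = foldr (\<lambda>i m. Suc (prod_encode (enc_instr i, m))) p l"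

lemma enc_app_simps [simp]:
  "enc_app [] l = l"
  "enc_app (i # p) l = Suc (prod_encode (enc_instr i, enc_app p l))"
  "enc_app (p @ q) l = enc_app p (enc_app q l)"
  by (simp_all add: enc_app_def)

lemma program_enc_app [simp]: "program (enc_app p 0) = p"
  by (induction p) (simp_all add: program_def)

text \<open>The command is fixed, but its address and the code behind it may vary with the input, as
  the s-m-n construction requires.\<close>

lemma cf_enc_compile [cf_intros]:
  "cf a \<Longrightarrow> cf l \<Longrightarrow> cf (\<lambda>x. enc_app (compile (a x) c) (l x))"
proof (induction c arbitrary: a l)
  case (SEQ c d)
  have "cf (\<lambda>x. enc_app (compile (a x) c) (enc_app (compile (a x + clen c) d) (l x)))"
    by (intro SEQ.IH SEQ.prems cf_intros)
  then show ?case by simp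
next
  case (LOOP r c)
  show ?case
    unfolding compile.simps enc_app_simps enc_instr.simps
    by (intro LOOP.IH LOOP.prems cf_intros)
next
  case (IFD r c d)
  show ?case
    unfolding compile.simps enc_app_simps enc_instr.simps
    by (intro IFD.IH IFD.prems cf_intros)
qed (simp_all, (intro cf_intros)?, simp_all)

lemma computable_cf: "cf f \<Longrightarrow> computable f"
proof -
  assume "cf f"
  then obtain C where C: "\<And>b s t. (\<And>i. i > b \<Longrightarrow> s i = 0) \<Longrightarrow> t = s(b := f (s b)) \<Longrightarrow> exec (C b) s t"
    by (elim cfE) blast
  let ?p = "compile 0 (C 0)" and ?s = "\<lambda>x. (\<lambda>_. 0)(0 := x :: nat)"
  have "\<exists>k. halted ?p (run (enc_app ?p 0) k x) \<and> snd (run (enc_app ?p 0) k x) 0 = f x" for x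
  proof -
    have "reach ?p (0, ?s x) (clen (C 0), ?s (f x))"
      using compile_correct[of "C 0" "?s x" "?s (f x)" ?p "[]" "[]"] C[of 0 "?s x" "?s (f x)"]
      by fastforce
    then obtain k where "run (enc_app ?p 0) k x = (clen (C 0), ?s (f x))"
      by (auto simp: reach_def run_def)
    then show ?thesis by (intro exI[of _ k]) (simp add: halted_def)
  qed
  then show ?thesis
    unfolding computable_def computes_def by (intro exI[of _ "enc_app ?p 0"]) simp
qed

fun INCS :: "nat \<Rightarrow> nat \<Rightarrow> com" where
  "INCS r 0 = SKIP"
| "INCS r (Suc n) = SEQ (INCS r n) (INC r)"

lemma exec_INCS: "exec (INCS r n) s (s(r := s r + n))"
proof (induction n)
  case (Suc n)
  then show ?case by (auto intro!: exec_SEQ exec_INC')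
qed (simp add: exec_SKIP)

lemma clen_INCS [simp]: "clen (INCS r n) = n"
  by (induction n) simp_all

lemma compile_INCS: "compile 0 (INCS r n) = map (\<lambda>i. Inc r (Suc i)) [0..<n]"
  by (induction n) simp_all

text \<open>Here the command itself grows with the input, so its code is built by primitive
  recursion, starting from the last instruction.\<close>

lemma cf_enc_INCS [cf_intros]:
  assumes "cf n" "cf l"
  shows "cf (\<lambda>x. enc_app (compile 0 (INCS r (n x))) (l x))"
proof -
  have *: "m \<le> k \<Longrightarrow> enc_app (map (\<lambda>i. Inc r (Suc i)) [k-m..<k]) v =
     rec_nat v (\<lambda>i w. Suc (prod_encode (2 * prod_encode (r, k - i), w))) m" for m k v
  proof (induction m)
    case (Suc m)
    then have "[k - Suc m..<k] = (k - Suc m) # [k - m..<k]"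
      by (metis Suc_diff_Suc Suc_le_lessD diff_Suc_less le_eq_less_or_eq less_nat_zero_code not_gr_zero upt_conv_Cons zero_less_Suc)
    moreover have "Suc (k - Suc m) = k - m" using Suc by simp
    ultimately show ?case using Suc by simp
  qed simp
  have "cf (\<lambda>x. rec_nat (l x) (\<lambda>i w. Suc (prod_encode (2 * prod_encode (r, n x - i), w))) (n x))"
    by (intro cf_intros assms cf_comp[OF assms(1)])
  then show ?thesis
    using *[OF order_refl] by (simp add: compile_INCS)
qed

text \<open>A form of the s-m-n theorem. The last instruction halts if register 0 is positive and
  otherwise jumps to itself.\<close>
lemma semidecider:
  assumes "dec (\<lambda>z. P (pfst z) (psnd z))"
  shows "\<exists>f. computable f \<and> (\<forall>n j. (\<exists>t. conv_within (f n) t j) \<longleftrightarrow> P n j)"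
proof -
  let ?g = "\<lambda>z. if P (pfst z) (psnd z) then 1 else 0 :: nat"
  obtain C where C: "\<And>b s t. (\<And>i. i > b \<Longrightarrow> s i = 0) \<Longrightarrow> t = s(b := ?g (s b)) \<Longrightarrow> exec (C b) s t"
    using assms unfolding dec_def by (elim cfE) blast
  define D where "D = SEQ (PAIR 0) (C 0)"
  define L where "L n = n + clen D" for n
  \<comment> \<open>Register \<open>1\<close> receives the parameter \<open>n\<close> while register
    \<open>0\<close> keeps the input \<open>j\<close>; from this layout \<open>PAIR 0\<close>
    produces \<open>prod_encode (n, j)\<close>.\<close>
  define p where "p n = compile 0 (INCS 1 n) @ compile n D @ [Dec 0 (Suc (L n)) (L n)]" for n
  define f where "f n = enc_app (p n) 0" for n
  have f: "program (f n) = p n" for n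
    by (simp add: f_def)
  have "cf f"
    unfolding f_def p_def L_def by (simp, intro cf_intros)
  moreover have "(\<exists>t. conv_within (f n) t j) \<longleftrightarrow> P n j" for n j
  proof -
    let ?s = "(\<lambda>_. 0)(0 := j)" and ?t = "(\<lambda>_. 0)(0 := if P n j then 1 else 0 :: nat)"
    have "exec (PAIR 0) (?s(1 := n)) ((\<lambda>_. 0)(0 := prod_encode (n, j)))"
      by (rule exec_PAIR) auto
    moreover have "exec (C 0) ((\<lambda>_. 0)(0 := prod_encode (n, j))) ?t"
      by (rule C) auto
    ultimately have "exec (SEQ (INCS 1 n) D) ?s ?t"
      unfolding D_def by (intro exec_SEQ exec_eq[OF exec_INCS]) (auto simp: fun_eq_iff)
    then have "reach (p n) (0, ?s) (L n, ?t)"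
      using compile_correct[of "SEQ (INCS 1 n) D" ?s ?t "p n" "[]" "[Dec 0 (Suc (L n)) (L n)]"]
      by (simp add: p_def L_def)
    then obtain k where k: "run (f n) k j = (L n, ?t)"
      by (auto simp: reach_def run_def f)
    have len: "length (p n) = Suc (L n)" and nth: "p n ! L n = Dec 0 (Suc (L n)) (L n)"
      by (simp_all add: p_def L_def nth_append)
    show ?thesis
    proof
      assume P: "P n j"
      have "run (f n) (Suc k) j = step (p n) (L n, ?t)"
        using k by (simp add: run_def f)
      then have "halted (program (f n)) (run (f n) (Suc k) j)"
        using P by (simp add: step_def len nth f halted_def)
      then show "\<exists>t. conv_within (f n) t j"
        by (auto simp: conv_within_iff)
    next
      assume "\<exists>t. conv_within (f n) t j"
      then obtain t where t: "halted (p n) (run (f n) t j)" by (auto simp: conv_within_iff f)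
      show "P n j"
      proof (rule ccontr)
        assume nP: "\<not> P n j"
        have "run (f n) (k + m) j = (L n, ?t)" for m
        proof (induction m)
          case (Suc m)
          then show ?case
            using nP by (simp add: run_def f) (simp add: step_def len nth)
        qed (simp only: k add_0_right)
        then have "\<not> halted (p n) (run (f n) (k + t) j)" by (simp add: halted_def len)
        then show False
          using run_halted[of "f n" t j "k + t"] t by (simp add: f)
      qed
    qed
  qed
  ultimately show ?thesis
    using computable_cf by blast
qed

lemma decidable3_dec:
  assumes "dec (\<lambda>z. R (pfst z) (pfst (psnd z)) (psnd (psnd z)))"
  shows "decidable3 R"
proof -
  have "(\<lambda>m. let (a, bc) = prod_decode m; (b, c) = prod_decode bc in if R a b c then 1 else 0) =
    (\<lambda>z. if R (pfst z) (pfst (psnd z)) (psnd (psnd z)) then 1 else 0 :: nat)"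
    by (auto simp: fun_eq_iff pfst_def psnd_def split: prod.split)
  then show ?thesis
    using assms unfolding decidable3_def dec_def by (auto intro: computable_cf)
qed

text \<open>A time bound absorbed into the universal quantifier makes the matrix of a \<open>\<Sigma>\<^sup>0\<^sub>2\<close>
  definition decidable in the sense of \<open>dec\<close>.\<close>
lemma Sigma02_dec:
  assumes "Sigma02 B"
  obtains R where "dec (\<lambda>z. R (pfst z) (pfst (psnd z)) (psnd (psnd z)))"
    "\<And>n. n \<in> B \<longleftrightarrow> (\<exists>x. \<forall>y. R n x y)"
proof -
  obtain R where R: "decidable3 R" "\<And>n. n \<in> B \<longleftrightarrow> (\<exists>x. \<forall>y. R n x y)"
    using assms unfolding Sigma02_def by blast
  let ?g = "\<lambda>m. let (a, bc) = prod_decode m; (b, c) = prod_decode bc in if R a b c then 1 else 0 :: nat"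
  obtain e where e: "\<And>m. \<exists>k. halted (program e) (run e k m) \<and> snd (run e k m) 0 = ?g m"
    using R(1) unfolding decidable3_def computable_def computes_def by blast
  \<comment> \<open>\<open>y\<close> carries both the quantified value and a time bound;
    \<open>R'\<close> fails only once the decider of \<open>R\<close> is seen to have halted with
    output \<open>0\<close>.\<close>
  define R' where "R' n x y = (\<not> (halted (program e)
      (run e (psnd y) (prod_encode (n, prod_encode (x, pfst y)))) \<and>
      snd (run e (psnd y) (prod_encode (n, prod_encode (x, pfst y)))) 0 = 0))" for n x y
  have "dec (\<lambda>z. R' (pfst z) (pfst (psnd z)) (psnd (psnd z)))"
    unfolding R'_def by (intro cf_intros)
  moreover have "(\<forall>y. R' n x y) \<longleftrightarrow> (\<forall>y. R n x y)" for n x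
  proof -
    have "(\<forall>t. R' n x (prod_encode (y, t))) \<longleftrightarrow> R n x y" for y
    proof -
      let ?m = "prod_encode (n, prod_encode (x, y))"
      obtain k where k: "halted (program e) (run e k ?m)"
        "snd (run e k ?m) 0 = (if R n x y then 1 else 0)"
        using e[of ?m] by auto
      have "snd (run e t ?m) 0 = (if R n x y then 1 else 0)" if "halted (program e) (run e t ?m)" for t
        using run_halted[OF k(1), of t] run_halted[OF that, of k] k(2) by (metis nat_le_linear)
      then show ?thesis
        using k by (auto simp: R'_def)
    qed
    then show ?thesis by (metis pair_pfst_psnd)
  qed
  ultimately show thesis
    using that R(2) by blast
qed

section \<open>Binary strings and their codes\<close>

text \<open>\<open>str_code\<close> is bijective base-2 notation with digits 1 and 2, least
  significant first, so the codes of the strings of one length form an interval.\<close>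

lemma str_code_bounds: "2 ^ length \<sigma> \<le> Suc (str_code \<sigma>) \<and> Suc (str_code \<sigma>) < 2 ^ Suc (length \<sigma>)"
  by (induction \<sigma>) auto

lemma str_code_inj: "str_code \<sigma> = str_code \<tau> \<Longrightarrow> \<sigma> = \<tau>"
proof (induction \<sigma> arbitrary: \<tau>)
  case Nil
  then show ?case by (cases \<tau>) (auto split: if_splits)
next
  case (Cons b \<sigma>)
  then obtain d \<rho> where \<tau>: "\<tau> = d # \<rho>" by (cases \<tau>) (auto split: if_splits)
  then have "2 * str_code \<sigma> + (if b then 2 else 1) = 2 * str_code \<rho> + (if d then 2 else 1)"
    using Cons.prems by simp
  then have "b = d \<and> str_code \<sigma> = str_code \<rho>"
    by (cases b; cases d; simp; presburger)
  then show ?case using Cons.IH \<tau> by blast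
qed

definition pcode :: "(nat \<Rightarrow> bool) \<Rightarrow> nat \<Rightarrow> nat" where
  "pcode x k = str_code (map x [0..<k])"

text \<open>Replaces strings by numbers below a power of two, so that conditions on prefixes become
  arithmetic and hence decidable.\<close>

lemma pcode_bit: "pcode (bit z) k = 2 ^ k - 1 + z mod 2 ^ k" for z :: nat
proof (induction k arbitrary: z)
  case (Suc k)
  have "map (bit z) [0..<Suc k] = odd z # map (bit (z div 2)) [0..<k]"
    by (simp only: map_upt_Suc) (simp add: bit_Suc fun_eq_iff bit_0)
  then have "pcode (bit z) (Suc k) = 2 * (2 ^ k - 1 + z div 2 mod 2 ^ k) + (if odd z then 2 else 1)"
    using Suc[of "z div 2"] by (simp add: pcode_def)
  moreover have "z mod 2 ^ Suc k = 2 * (z div 2 mod 2 ^ k) + z mod 2"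
    using mod_mult2_eq[of z 2 "2 ^ k"] by simp
  moreover have "(1::nat) \<le> 2 ^ k" by simp
  ultimately show ?case by (auto simp: odd_iff_mod_2_eq_one algebra_simps)
qed (simp add: pcode_def)

lemma pcode_eqD:
  assumes "pcode x k = pcode y l"
  shows "k = l" "\<And>i. i < k \<Longrightarrow> x i = y i"
proof -
  have *: "map x [0..<k] = map y [0..<l]"
    using assms str_code_inj unfolding pcode_def by blast
  from arg_cong[OF this, of length] show kl: "k = l" by simp
  show "x i = y i" if "i < k" for i
    using arg_cong[OF *, of "\<lambda>l. l ! i"] kl that by simp
qed

lemma pcode_cong: "(\<And>i. i < k \<Longrightarrow> x i = y i) \<Longrightarrow> pcode x k = pcode y k"
  unfolding pcode_def by (intro arg_cong[of _ _ str_code]) simp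

lemma pcode_bounds: "2 ^ k \<le> Suc (pcode x k)" "Suc (pcode x k) < 2 ^ Suc k"
  using str_code_bounds[of "map x [0..<k]"] by (simp_all add: pcode_def)

lemma ex_bits: "\<exists>z<2 ^ n. \<forall>k\<le>n. pcode x k = pcode (bit (z::nat)) k"
proof -
  let ?z = "horner_sum of_bool 2 (map x [0..<n]) :: nat"
  have "?z < 2 ^ n"
    using horner_sum_of_bool_2_less[of "map x [0..<n]"] by (simp add: nat_less_iff)
  moreover have "pcode x k = pcode (bit ?z) k" if "k \<le> n" for k
    using that by (intro pcode_cong) (simp add: bit_horner_sum_bit_iff)
  ultimately show ?thesis by blast
qed

text \<open>For the hardness part: an arithmetic test for strings that begin with \<open>x\<close>
  zeros and a one.\<close>

lemma mod_eq_exp_iff: "z mod 2 ^ Suc x = 2 ^ x \<longleftrightarrow> (\<forall>i\<le>x. bit z i = (i = x))" for z :: nat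
proof -
  have "z mod 2 ^ Suc x = 2 ^ x \<longleftrightarrow> (\<forall>i. bit (take_bit (Suc x) z) i = bit (2 ^ x :: nat) i)"
    by (simp only: take_bit_eq_mod[symmetric] bit_eq_iff) simp
  also have "\<dots> \<longleftrightarrow> (\<forall>i\<le>x. bit z i = (i = x))"
    by (auto simp: bit_take_bit_iff bit_exp_iff less_Suc_eq_le)
  finally show ?thesis .
qed

definition slen :: "nat \<Rightarrow> nat" where
  "slen i = (THE k. \<exists>x. pcode x k = i)"

lemma slen_pcode [simp]: "slen (pcode x k) = k"
  unfolding slen_def by (rule the_equality) (auto dest: pcode_eqD)

text \<open>The step bound in \<open>rtree\<close> is the length of the string, so a convergence on
  the prefix of length \<open>k\<close> at time \<open>t\<close> is noticed at length
  \<open>max t k\<close>.\<close>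

lemma mem_paths_rtree: "x \<in> paths (rtree e) \<longleftrightarrow> (\<forall>t k. \<not> conv_within e t (pcode x k))"
proof
  assume x: "x \<in> paths (rtree e)"
  show "\<forall>t k. \<not> conv_within e t (pcode x k)"
  proof (intro allI notI)
    fix t k assume c: "conv_within e t (pcode x k)"
    let ?n = "max t k"
    have "map x [0..<?n] \<in> rtree e" using x by (auto simp: paths_def)
    moreover have "map x [0..<?n] = map x [0..<k] @ map x [k..<?n]"
      using upt_add_eq_append[of 0 k "?n - k"] unfolding map_append[symmetric] by simp
    ultimately have "\<not> conv_within e ?n (pcode x k)"
      unfolding rtree_def pcode_def mem_Collect_eq length_map length_upt by (metis diff_zero)
    then show False
      using c by (force simp: conv_within_def)
  qed
next
  assume *: "\<forall>t k. \<not> conv_within e t (pcode x k)"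
  show "x \<in> paths (rtree e)"
    unfolding paths_def rtree_def
  proof (clarify)
    fix n \<tau> u
    assume e: "map x [0..<n] = \<tau> @ u" and c: "conv_within e (length (map x [0..<n])) (str_code \<tau>)"
    have "\<tau> = map x [0..<length \<tau>]"
      using arg_cong[OF e, of "take (length \<tau>)"] arg_cong[OF e, of length]
      by (simp add: take_map)
    then show False using * c unfolding pcode_def by metis
  qed
qed

text \<open>K\<ouml>nig's lemma, as compactness of Cantor space.\<close>
lemma uniform_bar:
  fixes G :: "nat \<Rightarrow> bool list \<Rightarrow> bool"
  assumes mono: "\<And>t t' \<tau>. t \<le> t' \<Longrightarrow> G t \<tau> \<Longrightarrow> G t' \<tau>"
    and bar: "\<And>x. \<exists>t k. G t (map x [0..<k])"
  shows "\<exists>n. \<forall>x. \<exists>k\<le>n. G n (map x [0..<k])"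
proof (rule ccontr)
  \<comment> \<open>A string is bad if no single bound serves all branches through it. Some child of
    a bad string is bad, since the larger of two bounds for its children would serve the string
    itself.\<close>
  define bad where "bad \<sigma> \<longleftrightarrow> (\<forall>n. \<exists>x. map x [0..<length \<sigma>] = \<sigma> \<and> (\<forall>k\<le>n. \<not> G n (map x [0..<k])))" for \<sigma>
  assume "\<not> ?thesis"
  then have bad0: "bad []" by (auto simp: bad_def)
  have badS: "\<exists>b. bad (\<sigma> @ [b])" if "bad \<sigma>" for \<sigma>
  proof (rule ccontr)
    assume "\<not> ?thesis"
    then have "\<exists>n. \<forall>x. map x [0..<Suc (length \<sigma>)] = \<sigma> @ [b] \<longrightarrow> (\<exists>k\<le>n. G n (map x [0..<k]))" for b
    proof -
      have "\<not> bad (\<sigma> @ [b])"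
        using \<open>\<not> (\<exists>b. bad (\<sigma> @ [b]))\<close> by blast
      then show ?thesis unfolding bad_def length_append_singleton by meson
    qed
    then obtain N where N: "\<And>b x. map x [0..<Suc (length \<sigma>)] = \<sigma> @ [b] \<Longrightarrow> \<exists>k\<le>N b. G (N b) (map x [0..<k])"
      by metis
    let ?n = "max (N True) (N False)"
    obtain x where x: "map x [0..<length \<sigma>] = \<sigma>" "\<And>k. k \<le> ?n \<Longrightarrow> \<not> G ?n (map x [0..<k])"
      using \<open>bad \<sigma>\<close> unfolding bad_def by blast
    have "map x [0..<Suc (length \<sigma>)] = \<sigma> @ [x (length \<sigma>)]"
      using x(1) by simp
    from N[OF this] obtain k where k: "k \<le> N (x (length \<sigma>))" "G (N (x (length \<sigma>))) (map x [0..<k])"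
      by blast
    have "N (x (length \<sigma>)) \<le> ?n" by (cases "x (length \<sigma>)") auto
    then show False
      using k x(2)[of k] mono by (meson order_trans)
  qed
  define f where "f = rec_nat [] (\<lambda>_ \<sigma>. \<sigma> @ [SOME b. bad (\<sigma> @ [b])])"
  have f: "f 0 = []" "f (Suc n) = f n @ [SOME b. bad (f n @ [b])]" for n
    by (simp_all add: f_def)
  have bad: "bad (f n)" for n
    by (induction n) (auto simp: f bad0 intro: someI_ex badS)
  have len: "length (f n) = n" for n
    by (induction n) (simp_all add: f)
  define x where "x i = f (Suc i) ! i" for i
  have fx: "map x [0..<n] = f n" for n
  proof (induction n)
    case (Suc n)
    have "f (Suc n) ! n = last (f (Suc n))" by (simp add: f len nth_append)
    then show ?case using Suc by (simp add: x_def) (simp add: f)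
  qed (simp add: f)
  obtain t k where tk: "G t (map x [0..<k])" using bar by blast
  \<comment> \<open>The branch \<open>x\<close> through bad strings meets the bar at length
    \<open>k\<close> and time \<open>t\<close>. Badness of its prefix of length \<open>?n\<close>
    gives a \<open>y\<close> that shares this prefix and yet avoids the bar.\<close>
  let ?n = "max t k"
  obtain y where y: "map y [0..<?n] = f ?n" "\<And>k. k \<le> ?n \<Longrightarrow> \<not> G ?n (map y [0..<k])"
    using bad[of ?n] by (auto simp: bad_def len)
  have "map y [0..<k] = map x [0..<k]"
    using y(1) unfolding fx[symmetric] by (auto dest: map_eq_conv[THEN iffD1])
  then show False
    using y(2)[of k] tk mono[of t ?n] by (metis max.cobounded1 max.cobounded2)
qed

section \<open>Positive Hausdorff measure via finite covers\<close>

lemma cantor_dist_le: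
  assumes "\<And>i. i < k \<Longrightarrow> x i = y i"
  shows "cantor_dist x y \<le> (1/2) ^ k"
proof (cases "x = y")
  case False
  then obtain i where "x i \<noteq> y i" by auto
  then have "x (LEAST n. x n \<noteq> y n) \<noteq> y (LEAST n. x n \<noteq> y n)"
    by (rule LeastI)
  then have "k \<le> (LEAST n. x n \<noteq> y n)"
    using assms by (meson not_le)
  then show ?thesis
    using False by (simp add: cantor_dist_def power_decreasing)
qed (simp add: cantor_dist_def)

lemma cdiam_le:
  assumes "\<And>x y i. x \<in> U \<Longrightarrow> y \<in> U \<Longrightarrow> i < k \<Longrightarrow> x i = y i"
  shows "cdiam U \<le> (1/2) ^ k"
proof (cases "U = {}")
  case False
  have "d \<le> (1/2) ^ k" if d: "d \<in> {cantor_dist x y | x y. x \<in> U \<and> y \<in> U}" for d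
    using d assms by (blast intro: cantor_dist_le)
  moreover have "{cantor_dist x y | x y. x \<in> U \<and> y \<in> U} \<noteq> {}"
    using False by blast
  ultimately show ?thesis
    using False unfolding cdiam_def by (auto intro!: cSup_least)
qed (simp add: cdiam_def)

lemma cantor_dist_le_cdiam:
  assumes "x \<in> U" "y \<in> U"
  shows "cantor_dist x y \<le> cdiam U"
proof -
  have "bdd_above {cantor_dist x y | x y. x \<in> U \<and> y \<in> U}"
    by (rule bdd_aboveI[of _ 1]) (use cantor_dist_le[of 0] in auto)
  then show ?thesis
    using assms unfolding cdiam_def by (auto intro!: cSup_upper)
qed

lemma cdiam_nonneg: "0 \<le> cdiam U"
proof (cases "U = {}")
  case False
  then obtain x where "x \<in> U" by auto
  from cantor_dist_le_cdiam[OF this this] show ?thesis by (simp add: cantor_dist_def)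
qed (simp add: cdiam_def)

text \<open>The string of the \<open>k\<close> low-order bits of \<open>z\<close> has code \<open>2 ^ k - 1 + z mod 2 ^ k\<close>, so \<open>z < 2 ^ n\<close>
  runs through the strings of length \<open>n\<close> and \<open>k\<close> through their prefixes.\<close>
definition cover_at :: "nat \<Rightarrow> nat \<Rightarrow> nat set \<Rightarrow> bool" where
  "cover_at e n F \<longleftrightarrow> (\<forall>z<2 ^ n. \<exists>k<Suc n.
     2 ^ k - 1 + z mod 2 ^ k \<in> F \<or> conv_within e n (2 ^ k - 1 + z mod 2 ^ k))"

text \<open>\<open>h k\<close> stands for \<open>\<lfloor>s k\<rfloor>\<close>; the factor \<open>2 ^ n\<close> clears denominators.\<close>
definition weight :: "(nat \<Rightarrow> nat) \<Rightarrow> nat \<Rightarrow> nat set \<Rightarrow> nat" where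
  "weight h n F = (\<Sum>k<Suc n. \<Sum>z<2 ^ k. if 2 ^ k - 1 + z \<in> F then 2 ^ (n - h k) else 0)"

text \<open>Listing the strings by length runs through their codes consecutively, so the double sum
  is a sum over an initial segment.\<close>

lemma weight_eq: "weight h n F = (\<Sum>i\<in>F \<inter> {..<2 ^ Suc n - 1}. 2 ^ (n - h (slen i)))"
proof -
  have split: "(\<Sum>i<a + b. g i) = (\<Sum>i<a. g i) + (\<Sum>z<b. g (a + z))" for g :: "nat \<Rightarrow> nat" and a b
    by (induction b) simp_all
  have *: "(\<Sum>k<m. \<Sum>z<2 ^ k. g (2 ^ k - 1 + z)) = (\<Sum>i<2 ^ m - 1. g i)" for g :: "nat \<Rightarrow> nat" and m
  proof (induction m)
    case (Suc m)
    have "(\<Sum>i<2 ^ Suc m - 1. g i) = (\<Sum>i<(2 ^ m - 1) + 2 ^ m. g i)"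
      by (intro sum.cong) auto
    also have "\<dots> = (\<Sum>i<2 ^ m - 1. g i) + (\<Sum>z<2 ^ m. g (2 ^ m - 1 + z))"
      by (rule split)
    finally show ?case using Suc by simp
  qed simp
  have "slen (2 ^ k - 1 + z) = k" if "z < 2 ^ k" for z k
    using slen_pcode[of "bit z" k] that by (simp add: pcode_bit)
  then have "weight h n F = (\<Sum>k<Suc n. \<Sum>z<2 ^ k.
      (\<lambda>i. if i \<in> F then 2 ^ (n - h (slen i)) else 0) (2 ^ k - 1 + z))"
    unfolding weight_def by (intro sum.cong) auto
  also have "\<dots> = (\<Sum>i<2 ^ Suc n - 1. if i \<in> F then 2 ^ (n - h (slen i)) else 0)"
    by (rule *)
  also have "\<dots> = (\<Sum>i\<in>F \<inter> {..<2 ^ Suc n - 1}. 2 ^ (n - h (slen i)))"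
    by (simp add: sum.inter_restrict[symmetric] Int_commute sum.If_cases)
  finally show ?thesis .
qed

text \<open>The constant cover by \<open>{x}\<close> has diameter \<open>0\<close>, and
  \<open>0 powr s = 0\<close> for every real \<open>s\<close>, even for
  \<open>s = 0\<close>.\<close>

lemma hausdorff_zero_singleton:
  assumes "A \<subseteq> {x}"
  shows "hausdorff_cantor s A = 0"
proof -
  have d: "cdiam {x} = 0"
    by (simp add: cdiam_def cantor_dist_def)
  have "hausdorff_cantor s A \<le> 0"
    unfolding hausdorff_cantor_def
  proof (rule SUP_least)
    fix \<delta> :: real assume "\<delta> \<in> {0<..}"
    then show "(INF U\<in>{U :: nat \<Rightarrow> (nat \<Rightarrow> bool) set. A \<subseteq> (\<Union>i. U i) \<and> (\<forall>i. cdiam (U i) \<le> \<delta>)}.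
         (\<Sum>i. ennreal (cdiam (U i) powr s))) \<le> 0"
      using assms by (intro INF_lower2[of "\<lambda>_. {x}"]) (auto simp: d)
  qed
  then show ?thesis by simp
qed

text \<open>\<open>h\<close> approximates \<open>s k\<close> from below with error at most 1;
  rationality of \<open>s\<close> will supply a computable \<open>h\<close>.\<close>

locale dimension =
  fixes s :: real and h :: "nat \<Rightarrow> nat"
  assumes s: "0 < s" "s < 1" and h: "\<And>k. real (h k) \<le> s * k" "\<And>k. s * k \<le> real (h k) + 1"
begin

lemma h_le: "h k \<le> k"
proof -
  have "s * real k \<le> 1 * real k" using s by (intro mult_right_mono) auto
  with h(1)[of k] have "real (h k) \<le> real k" by simp
  then show ?thesis by simp
qed

lemma powr_half: "((1/2) ^ k) powr s = (1/2) powr (s * k)"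
  by (simp add: powr_realpow[symmetric] powr_powr mult.commute)

lemma half_powr_le: "((1/2) ^ k) powr s \<le> (1/2) ^ h k"
proof -
  have "(1/2) powr (s * k) \<le> (1/2) powr (real (h k))"
    using h(1)[of k] by (intro powr_mono') auto
  then show ?thesis by (simp add: powr_half powr_realpow)
qed

lemma half_powr_ge: "(1/2) ^ h k \<le> 2 * ((1/2) ^ k) powr s"
proof -
  have "(1/2 :: real) powr (real (h k + 1)) \<le> (1/2) powr (s * k)"
    using h(2)[of k] by (intro powr_mono') auto
  then have "(1/2 :: real) ^ (h k + 1) \<le> (1/2) powr (s * k)"
    by (subst (asm) powr_realpow) auto
  then show ?thesis by (simp add: powr_half)
qed

lemma half_h_small: "0 < \<epsilon> \<Longrightarrow> \<exists>k. (1/2 :: real) ^ h k \<le> \<epsilon>"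
proof -
  assume "0 < \<epsilon>"
  then obtain N where N: "(1/2 :: real) ^ N < \<epsilon>"
    using real_arch_pow_inv[of \<epsilon> "1/2"] by auto
  obtain k :: nat where k: "(real N + 1) / s \<le> k"
    using real_arch_simple by blast
  then have "real N + 1 \<le> s * k" using s by (simp add: field_simps)
  with h(2)[of k] have "N \<le> h k" by simp
  then have "(1/2 :: real) ^ h k \<le> (1/2) ^ N" by (intro power_decreasing) auto
  with N show ?thesis by (intro exI[of _ k]) linarith
qed

text \<open>Codes below \<open>2 ^ Suc n - 1\<close> belong to strings of length at most
  \<open>n\<close>, and \<open>h k \<le> k\<close>, so the subtraction \<open>n - h k\<close> in
  \<open>weight\<close> is not truncated.\<close>

lemma scaled_weight:
  assumes "F \<subseteq> range (\<lambda>(x, k). pcode x k)"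
  shows "real (weight h n F) = 2 ^ n * (\<Sum>i\<in>F \<inter> {..<2 ^ Suc n - 1}. (1/2) ^ h (slen i))"
proof -
  have "real (weight h n F) = (\<Sum>i\<in>F \<inter> {..<2 ^ Suc n - 1}. 2 ^ (n - h (slen i)))"
    by (simp add: weight_eq)
  also have "\<dots> = (\<Sum>i\<in>F \<inter> {..<2 ^ Suc n - 1}. 2 ^ n * (1/2) ^ h (slen i))"
  proof (intro sum.cong refl)
    fix i assume i: "i \<in> F \<inter> {..<2 ^ Suc n - 1}"
    then obtain x k where k: "i = pcode x k" using assms by fastforce
    have "(2::nat) ^ k < 2 ^ Suc n" using pcode_bounds(1)[of k x] i k by auto
    then have "k < Suc n" by (rule power_less_imp_less_exp[rotated]) simp
    then have "k \<le> n" by simp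
    then have "h (slen i) \<le> n" using h_le[of k] k by simp
    then show "(2::real) ^ (n - h (slen i)) = 2 ^ n * (1/2) ^ h (slen i)"
      by (simp add: power_diff power_one_over)
  qed
  finally show ?thesis by (simp add: sum_distrib_left)
qed

text \<open>The error \<open>\<epsilon>\<close> is there for the sets of diameter zero.\<close>
lemma ex_cylinder:
  assumes "0 < \<epsilon>"
  shows "\<exists>x k. (\<forall>y\<in>U. pcode y k = pcode x k) \<and> (1/2) ^ h k \<le> 2 * cdiam U powr s + \<epsilon>"
proof (cases "\<exists>x y. x \<in> U \<and> y \<in> U \<and> x \<noteq> y")
  case False
  obtain k where k: "(1/2 :: real) ^ h k \<le> \<epsilon>" using half_h_small[OF assms] by blast
  obtain x where "\<forall>y\<in>U. y = x" using False by metis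
  moreover have "(1/2) ^ h k \<le> 2 * cdiam U powr s + \<epsilon>"
    using k powr_ge_zero[of "cdiam U" s] by linarith
  ultimately show ?thesis by (intro exI[of _ x] exI[of _ k]) auto
next
  case True
  then obtain x y n where xy: "x \<in> U" "y \<in> U" "x n \<noteq> y n" by (auto simp: fun_eq_iff)
  \<comment> \<open>\<open>k\<close> is the first place where some element of \<open>U\<close>
    departs from \<open>x\<close>: all of \<open>U\<close> agrees below \<open>k\<close>, and the
    diameter is at least \<open>(1/2) ^ k\<close>.\<close>
  define k where "k = (LEAST n. \<exists>y\<in>U. x n \<noteq> y n)"
  have "\<exists>y\<in>U. x k \<noteq> y k"
    unfolding k_def by (rule LeastI[of _ n]) (use xy in auto)
  then obtain y where y: "y \<in> U" "x k \<noteq> y k" by blast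
  have k: "x i = y i" if "y \<in> U" "i < k" for y i
    using not_less_Least[of i "\<lambda>n. \<exists>y\<in>U. x n \<noteq> y n"] that unfolding k_def by blast
  have "(LEAST n. x n \<noteq> y n) = k"
    using y k by (intro Least_equality) (auto simp: not_le[symmetric])
  then have "(1/2) ^ k \<le> cdiam U"
    using cantor_dist_le_cdiam[OF xy(1) y(1)] y(2) by (auto simp: cantor_dist_def split: if_splits)
  then have "((1/2) ^ k) powr s \<le> cdiam U powr s"
    using s by (intro powr_mono2) auto
  then have "(1/2) ^ h k \<le> 2 * cdiam U powr s + \<epsilon>"
    using half_powr_ge[of k] assms by linarith
  moreover have "\<forall>y\<in>U. pcode y k = pcode x k"
    using k by (auto intro!: pcode_cong)
  ultimately show ?thesis by blast
qed

text \<open>A countable cover of small total weight is enlarged to cylinders, and compactness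
  extracts a finite \<open>F\<close> that is too light for the hypothesis.\<close>

lemma hausdorff_pos:
  assumes c: "\<And>n F. finite F \<Longrightarrow> cover_at e n F \<Longrightarrow> 2 ^ n \<le> 2 ^ c * weight h n F"
  shows "0 < hausdorff_cantor s (paths (rtree e))"
proof -
  \<comment> \<open>The cylinders weigh at most \<open>2 * \<epsilon>\<close> from the factor 2 in
    \<open>ex_cylinder\<close> plus \<open>2 * \<epsilon>\<close> from the errors
    \<open>\<epsilon> * (1/2) ^ i\<close>; the total \<open>4 * \<epsilon>\<close> is half of
    \<open>(1/2) ^ c\<close>.\<close>
  define \<epsilon> :: real where "\<epsilon> = (1/2) ^ c / 8"
  have \<epsilon>: "0 < \<epsilon>" by (simp add: \<epsilon>_def)
  have "ennreal \<epsilon> \<le> (\<Sum>i. ennreal (cdiam (U i) powr s))"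
    if cov: "paths (rtree e) \<subseteq> (\<Union>i. U i)" for U :: "nat \<Rightarrow> (nat \<Rightarrow> bool) set"
  proof (rule ccontr)
    assume "\<not> ?thesis"
    then have less: "(\<Sum>i. ennreal (cdiam (U i) powr s)) < ennreal \<epsilon>" by simp
    have "\<exists>x k. (\<forall>y\<in>U i. pcode y k = pcode x k) \<and>
        (1/2) ^ h k \<le> 2 * cdiam (U i) powr s + \<epsilon> * (1/2) ^ i" for i
      using \<epsilon> by (intro ex_cylinder) simp
    then obtain xs ks where U: "\<And>i y. y \<in> U i \<Longrightarrow> pcode y (ks i) = pcode (xs i) (ks i)"
      and le: "\<And>i. (1/2) ^ h (ks i) \<le> 2 * cdiam (U i) powr s + \<epsilon> * (1/2) ^ i"
      by metis
    \<comment> \<open>The bar: a string is one of the first \<open>t + 1\<close> cylinders or is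
      seen by time \<open>t\<close> to leave the tree. Paths meet the former, all other sequences
      the latter.\<close>
    define G where "G t \<tau> \<longleftrightarrow> (\<exists>i\<le>t. str_code \<tau> = pcode (xs i) (ks i)) \<or> conv_within e t (str_code \<tau>)" for t \<tau>
    have "\<exists>n. \<forall>x. \<exists>k\<le>n. G n (map x [0..<k])"
    proof (rule uniform_bar)
      show "G t' \<tau>" if "t \<le> t'" "G t \<tau>" for t t' \<tau>
        using that unfolding G_def conv_within_def by (meson order_trans)
      show "\<exists>t k. G t (map x [0..<k])" for x
      proof (cases "x \<in> paths (rtree e)")
        case True
        then obtain i where "x \<in> U i" using cov by auto
        from U[OF this] show ?thesis unfolding G_def pcode_def by blast
      next
        case False
        then show ?thesis unfolding G_def mem_paths_rtree pcode_def by blast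
      qed
    qed
    then obtain n where n: "\<And>x. \<exists>k\<le>n. G n (map x [0..<k])" by blast
    define F where "F = (\<lambda>i. pcode (xs i) (ks i)) ` {..n}"
    have F: "finite F" by (simp add: F_def)
    have "cover_at e n F"
      unfolding cover_at_def
    proof (intro allI impI)
      fix z :: nat
      obtain k where "k \<le> n" "G n (map (bit z) [0..<k])" using n by blast
      then show "\<exists>k<Suc n. 2 ^ k - 1 + z mod 2 ^ k \<in> F \<or> conv_within e n (2 ^ k - 1 + z mod 2 ^ k)"
        unfolding G_def pcode_def[symmetric, of "bit z"] pcode_bit F_def
        by (intro exI[of _ k]) auto
    qed
    from c[OF F this] have "real (2 ^ n) \<le> real (2 ^ c * weight h n F)" by (rule of_nat_mono)
    moreover have "real (weight h n F) \<le> 2 ^ n * (4 * \<epsilon>)"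
    proof -
      have "(\<Sum>i\<in>F \<inter> {..<2 ^ Suc n - 1}. (1/2 :: real) ^ h (slen i)) \<le> (\<Sum>i\<in>F. (1/2) ^ h (slen i))"
        using F by (intro sum_mono2) auto
      also have "\<dots> \<le> (\<Sum>i\<le>n. (1/2) ^ h (ks i))"
        unfolding F_def using sum_image_le[of "{..n}" "\<lambda>i. (1/2 :: real) ^ h (slen i)" "\<lambda>i. pcode (xs i) (ks i)"]
        by (simp add: o_def)
      also have "\<dots> \<le> (\<Sum>i\<le>n. 2 * cdiam (U i) powr s + \<epsilon> * (1/2) ^ i)"
        by (intro sum_mono le)
      also have "\<dots> = 2 * (\<Sum>i\<le>n. cdiam (U i) powr s) + \<epsilon> * (\<Sum>i\<le>n. (1/2) ^ i)"
        by (simp add: sum.distrib sum_distrib_left)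
      also have "\<dots> \<le> 2 * \<epsilon> + \<epsilon> * 2"
      proof (intro add_mono mult_left_mono)
        have "ennreal (\<Sum>i\<le>n. cdiam (U i) powr s) = (\<Sum>i\<le>n. ennreal (cdiam (U i) powr s))"
          by (simp add: sum_ennreal)
        also have "\<dots> \<le> (\<Sum>i. ennreal (cdiam (U i) powr s))"
          by (intro sum_le_suminf) auto
        finally have "ennreal (\<Sum>i\<le>n. cdiam (U i) powr s) < ennreal \<epsilon>" using less by simp
        then show "(\<Sum>i\<le>n. cdiam (U i) powr s) \<le> \<epsilon>"
          by (simp add: ennreal_less_iff sum_nonneg)
        have "(\<Sum>i\<le>n. (1/2 :: real) ^ i) = 2 - (1/2) ^ n"
          by (induction n) simp_all
        then show "(\<Sum>i\<le>n. (1/2 :: real) ^ i) \<le> 2" by simp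
      qed (use \<epsilon> in auto)
      finally have "(\<Sum>i\<in>F \<inter> {..<2 ^ Suc n - 1}. (1/2 :: real) ^ h (slen i)) \<le> 4 * \<epsilon>" by simp
      moreover have "F \<subseteq> range (\<lambda>(x, k). pcode x k)" by (auto simp: F_def)
      ultimately show ?thesis by (simp add: scaled_weight)
    qed
    then have "2 ^ c * real (weight h n F) \<le> 2 ^ c * (2 ^ n * (4 * \<epsilon>))"
      by (intro mult_left_mono) auto
    moreover have "2 ^ c * (2 ^ n * (4 * \<epsilon>)) = 2 ^ n / 2"
      by (simp add: \<epsilon>_def power_one_over)
    moreover have "(0::real) < 2 ^ n" by simp
    ultimately show False by simp
  qed
  \<comment> \<open>The bound holds for covers by sets of any diameter, so the scale
    \<open>1\<close> serves.\<close>
  then have "ennreal \<epsilon> \<le> hausdorff_cantor s (paths (rtree e))"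
    unfolding hausdorff_cantor_def by (intro SUP_upper2[of 1] INF_greatest) auto
  moreover have "0 < ennreal \<epsilon>" using \<epsilon> by simp
  ultimately show ?thesis by (rule less_le_trans[rotated])
qed

text \<open>Light covers are automatically fine: each summand \<open>(1/2) ^ h k\<close> lies below
  the total and, as \<open>h k \<le> k\<close>, bounds the diameter \<open>(1/2) ^ k\<close>. So one
  small \<open>m\<close> controls both the sum and the scale.\<close>

lemma hausdorff_zero:
  assumes c: "\<And>c. \<exists>n F. cover_at e n F \<and> 2 ^ c * weight h n F < 2 ^ n"
  shows "hausdorff_cantor s (paths (rtree e)) = 0"
proof -
  define H where "H \<delta> = (INF U\<in>{U :: nat \<Rightarrow> (nat \<Rightarrow> bool) set.
     paths (rtree e) \<subseteq> (\<Union>i. U i) \<and> (\<forall>i. cdiam (U i) \<le> \<delta>)}. (\<Sum>i. ennreal (cdiam (U i) powr s)))" for \<delta> :: real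
  have H_le: "H \<delta> \<le> ennreal \<epsilon>" if \<delta>: "0 < \<delta>" and \<epsilon>: "0 < \<epsilon>" for \<delta> \<epsilon> :: real
  proof -
    obtain m where m: "(1/2 :: real) ^ m < min \<delta> \<epsilon>"
      using real_arch_pow_inv[of "min \<delta> \<epsilon>" "1/2"] \<delta> \<epsilon> by auto
    obtain n F0 where F0: "cover_at e n F0" "2 ^ m * weight h n F0 < 2 ^ n"
      using c by blast
    \<comment> \<open>\<open>cover_at\<close> looks only at strings of length at most
      \<open>n\<close>, so cutting down to their codes keeps the covering property and makes the set
      finite.\<close>
    define F where "F = F0 \<inter> {..<2 ^ Suc n - 1} \<inter> range (\<lambda>(x, k). pcode x k)"
    have "finite F" by (simp add: F_def)
    let ?W = "\<Sum>i\<in>F. (1/2 :: real) ^ h (slen i)"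
    have FI: "F \<inter> {..<2 ^ Suc n - 1} = F" by (auto simp: F_def)
    have W: "?W < (1/2) ^ m"
    proof -
      have "weight h n F \<le> weight h n F0"
        unfolding weight_eq by (intro sum_mono2) (auto simp: F_def)
      then have "2 ^ m * weight h n F < 2 ^ n"
        using F0(2) by (meson le_less_trans mult_le_mono2)
      then have "real (2 ^ m * weight h n F) < real (2 ^ n)"
        by (simp only: of_nat_less_iff)
      moreover have "real (weight h n F) = 2 ^ n * ?W"
        using scaled_weight[of F n] unfolding FI by (auto simp: F_def)
      ultimately have "2 ^ n * (2 ^ m * ?W) < 2 ^ n * 1" by (simp add: mult.left_commute)
      then have "2 ^ m * ?W < 1" by (subst (asm) mult_less_cancel_left_pos) auto
      then have "?W < 1 / 2 ^ m" by (subst pos_less_divide_eq) (simp_all add: mult.commute)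
      then show ?thesis by (simp only: power_one_over)
    qed
    have W1: "(1/2 :: real) ^ h (slen i) < (1/2) ^ m" if "i \<in> F" for i
    proof -
      have "(1/2 :: real) ^ h (slen i) \<le> ?W"
        using that \<open>finite F\<close> by (intro member_le_sum) auto
      then show ?thesis using W by linarith
    qed
    \<comment> \<open>The cover is indexed by the codes themselves; the empty sets elsewhere
      contribute nothing, as \<open>cdiam {} = 0\<close> and \<open>0 powr s = 0\<close>.\<close>
    define U where "U i = (if i \<in> F then {x. pcode x (slen i) = i} else {})" for i
    have diam: "cdiam (U i) \<le> (1/2) ^ slen i" for i
    proof (rule cdiam_le)
      fix x y j assume "x \<in> U i" "y \<in> U i" "j < slen i"
      then have "pcode x (slen i) = pcode y (slen i)" by (auto simp: U_def split: if_splits)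
      then show "x j = y j" using \<open>j < slen i\<close> by (rule pcode_eqD(2))
    qed
    have "paths (rtree e) \<subseteq> (\<Union>i. U i)"
    proof
      fix x assume x: "x \<in> paths (rtree e)"
      obtain z where z: "z < 2 ^ n" "\<And>k. k \<le> n \<Longrightarrow> pcode x k = 2 ^ k - 1 + z mod 2 ^ k"
        using ex_bits[of n x] by (auto simp: pcode_bit)
      obtain k where k: "k < Suc n"
        "2 ^ k - 1 + z mod 2 ^ k \<in> F0 \<or> conv_within e n (2 ^ k - 1 + z mod 2 ^ k)"
        using F0(1) z(1) unfolding cover_at_def by blast
      have "k \<le> n" using k(1) by simp
      then have "pcode x k \<in> F0"
        using k(2) x unfolding mem_paths_rtree by (simp only: z(2)[symmetric]) blast
      moreover have "(2::nat) ^ Suc k \<le> 2 ^ Suc n" using k(1) by (intro power_increasing) auto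
      then have "pcode x k < 2 ^ Suc n - 1" using pcode_bounds(2)[of x k] by linarith
      ultimately have "pcode x k \<in> F" unfolding F_def by auto
      then have "x \<in> U (pcode x k)" by (simp add: U_def)
      then show "x \<in> (\<Union>i. U i)" by blast
    qed
    moreover have "cdiam (U i) \<le> \<delta>" for i
    proof (cases "i \<in> F")
      case True
      have "(1/2 :: real) ^ slen i \<le> (1/2) ^ h (slen i)"
        by (intro power_decreasing h_le) auto
      moreover have "(1/2 :: real) ^ m < \<delta>" using m by simp
      ultimately show ?thesis using diam[of i] W1[OF True] by linarith
    qed (use \<delta> in \<open>simp add: U_def cdiam_def\<close>)
    moreover have "(\<Sum>i. ennreal (cdiam (U i) powr s)) \<le> ennreal \<epsilon>"
    proof -
      have "(\<Sum>i. ennreal (cdiam (U i) powr s)) = (\<Sum>i\<in>F. ennreal (cdiam (U i) powr s))"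
        using \<open>finite F\<close> by (intro suminf_finite) (auto simp: U_def cdiam_def)
      also have "\<dots> \<le> (\<Sum>i\<in>F. ennreal ((1/2) ^ h (slen i)))"
      proof (intro sum_mono ennreal_leI)
        fix i
        have "cdiam (U i) powr s \<le> ((1/2) ^ slen i) powr s"
          using s by (intro powr_mono2 diam cdiam_nonneg) auto
        then show "cdiam (U i) powr s \<le> (1/2) ^ h (slen i)"
          using half_powr_le[of "slen i"] by linarith
      qed
      also have "\<dots> = ennreal ?W" by (simp add: sum_ennreal)
      also have "\<dots> \<le> ennreal \<epsilon>" using W m by (intro ennreal_leI) simp
      finally show ?thesis .
    qed
    ultimately show ?thesis
      unfolding H_def by (intro INF_lower2[of U] CollectI conjI allI)
  qed
  have "H \<delta> \<le> 0" if "0 < \<delta>" for \<delta>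
    by (rule ennreal_le_epsilon) (simp add: H_le that)
  then have "(SUP \<delta>\<in>{0<..}. H \<delta>) \<le> 0"
    by (intro SUP_least) simp
  then show ?thesis
    unfolding hausdorff_cantor_def H_def[symmetric] by simp
qed

text \<open>Each string of length \<open>k\<close> has at most \<open>2 ^ (n - k)\<close> extensions of length \<open>n\<close>, so a cover of a
  cylinder has at least the Lebesgue measure of the cylinder.\<close>
lemma hausdorff_pos_cylinder:
  assumes cyl: "\<And>x. (\<And>i. i \<le> a \<Longrightarrow> x i = (i = a)) \<Longrightarrow> x \<in> paths (rtree e)"
  shows "0 < hausdorff_cantor s (paths (rtree e))"
proof (rule hausdorff_pos[where c = "Suc a"])
  fix n F
  assume F: "finite F" "cover_at e n F"
  \<comment> \<open>The length-\<open>n\<close> prefixes of branches beginning with \<open>a\<close>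
    zeros and a one, read as numbers. If \<open>n \<le> a\<close>, the truncated exponent and the
    \<open>mod\<close> leave only the number \<open>0\<close>.\<close>
  define Z where "Z = (\<lambda>u::nat. (2 ^ a + u * 2 ^ Suc a) mod 2 ^ n) ` {..<2 ^ (n - Suc a)}"
  define C where "C = (\<lambda>i. {z::nat. z < 2 ^ n \<and> pcode (bit z) (slen i) = i})"
  let ?F = "F \<inter> {..<2 ^ Suc n - 1}"
  have "Z \<subseteq> (\<Union>i\<in>?F. C i)"
  proof
    fix z assume "z \<in> Z"
    then obtain u where u: "u < 2 ^ (n - Suc a)" "z = (2 ^ a + u * 2 ^ Suc a) mod 2 ^ n"
      by (auto simp: Z_def)
    let ?y = "2 ^ a + u * 2 ^ Suc a"
    have "z < 2 ^ n" using u by simp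
    then obtain k where k: "k < Suc n"
      "2 ^ k - 1 + z mod 2 ^ k \<in> F \<or> conv_within e n (2 ^ k - 1 + z mod 2 ^ k)"
      using F(2) unfolding cover_at_def by blast
    have zk: "z mod 2 ^ k = ?y mod 2 ^ k"
      using k(1) unfolding u(2) by (intro mod_mod_cancel le_imp_power_dvd) simp
    have "bit ?y \<in> paths (rtree e)"
    proof (rule cyl)
      fix i assume "i \<le> a"
      have "bit ?y i = bit (?y mod 2 ^ Suc a) i"
        using \<open>i \<le> a\<close> by (simp only: take_bit_eq_mod[symmetric] bit_take_bit_iff) simp
      also have "?y mod 2 ^ Suc a = 2 ^ a"
        by (subst mod_mult_self1) simp
      finally show "bit ?y i = (i = a)" by (auto simp: bit_exp_iff)
    qed
    then have "pcode (bit z) k \<in> F"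
      using k(2) unfolding mem_paths_rtree pcode_bit zk by blast
    moreover have "(2::nat) ^ Suc k \<le> 2 ^ Suc n" using k(1) by (intro power_increasing) auto
    then have "pcode (bit z) k < 2 ^ Suc n - 1" using pcode_bounds(2)[of "bit z" k] by linarith
    ultimately show "z \<in> (\<Union>i\<in>?F. C i)"
      using \<open>z < 2 ^ n\<close> by (auto simp: C_def intro!: bexI[of _ "pcode (bit z) k"])
  qed
  moreover have "finite (C i)" for i by (simp add: C_def)
  ultimately have "card Z \<le> card (\<Union>i\<in>?F. C i)"
    by (intro card_mono) (auto simp: F)
  also have "\<dots> \<le> (\<Sum>i\<in>?F. card (C i))"
    using F(1) by (intro card_UN_le) simp
  also have "\<dots> \<le> (\<Sum>i\<in>?F. 2 ^ (n - h (slen i)))"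
  proof (rule sum_mono)
    fix i
    let ?k = "slen i"
    show "card (C i) \<le> 2 ^ (n - h ?k)"
    proof (cases "?k \<le> n")
      case True
      have "card (C i) \<le> card {..<2 ^ (n - ?k) :: nat}"
      proof (rule card_inj_on_le[of "\<lambda>z. z div 2 ^ ?k"])
        show "inj_on (\<lambda>z. z div 2 ^ ?k) (C i)"
        proof (rule inj_onI)
          fix z w assume "z \<in> C i" "w \<in> C i" and d: "z div 2 ^ ?k = w div 2 ^ ?k"
          then have "2 ^ ?k - 1 + z mod 2 ^ ?k = 2 ^ ?k - 1 + w mod 2 ^ ?k"
            unfolding C_def pcode_bit by simp
          then have "z mod 2 ^ ?k = w mod 2 ^ ?k" by (rule add_left_imp_eq)
          with d show "z = w" by (metis div_mult_mod_eq)
        qed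
        show "(\<lambda>z. z div 2 ^ ?k) ` C i \<subseteq> {..<2 ^ (n - ?k)}"
          using True by (auto simp: C_def less_mult_imp_div_less power_add[symmetric])
      qed simp
      \<comment> \<open>Here \<open>s < 1\<close> enters through \<open>h k \<le> k\<close>: a
        weight is at least the number of extensions it has to account for.\<close>
      also have "\<dots> \<le> 2 ^ (n - h ?k)" using h_le[of ?k] by simp
      finally show ?thesis .
    next
      case False
      \<comment> \<open>The bits below \<open>slen i > n\<close> determine all of
        \<open>z < 2 ^ n\<close>.\<close>
      have "z = w" if "z \<in> C i" "w \<in> C i" for z w
      proof -
        have "(2::nat) ^ n \<le> 2 ^ ?k" using False by (intro power_increasing) auto
        then have "z < 2 ^ ?k" "w < 2 ^ ?k" using that unfolding C_def by (blast intro: less_le_trans)+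
        moreover have "2 ^ ?k - 1 + z mod 2 ^ ?k = 2 ^ ?k - 1 + w mod 2 ^ ?k"
          using that unfolding C_def pcode_bit by simp
        then have "z mod 2 ^ ?k = w mod 2 ^ ?k" by (rule add_left_imp_eq)
        ultimately show ?thesis by simp
      qed
      then have "card (C i) \<le> 1" by (metis One_nat_def card_le_Suc0_iff_eq C_def finite_Collect_conjI finite_Collect_less_nat)
      also have "(1::nat) \<le> 2 ^ (n - h ?k)" by simp
      finally show ?thesis .
    qed
  qed
  finally have "card Z \<le> weight h n F" by (simp only: weight_eq)
  moreover have "card Z = 2 ^ (n - Suc a)"
  proof (cases "Suc a \<le> n")
    case True
    have "(2 ^ a + u * 2 ^ Suc a) < 2 ^ n" if "u < 2 ^ (n - Suc a)" for u :: nat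
    proof -
      have "2 ^ a + u * 2 ^ Suc a < Suc u * 2 ^ Suc a" by simp
      also have "\<dots> \<le> 2 ^ (n - Suc a) * 2 ^ Suc a" using that by (intro mult_le_mono1) simp
      also have "\<dots> = 2 ^ n" using True by (simp only: power_add[symmetric]) simp
      finally show ?thesis .
    qed
    then show ?thesis
      unfolding Z_def by (subst card_image) (auto intro!: inj_onI)
  next
    case False
    then have "n - Suc a = 0" by simp
    then show ?thesis unfolding Z_def by (simp add: lessThan_Suc)
  qed
  ultimately have "2 ^ Suc a * 2 ^ (n - Suc a) \<le> 2 ^ Suc a * weight h n F" by simp
  \<comment> \<open>An inequality and not an equation, because \<open>n - Suc a\<close> is truncated
    when \<open>n \<le> a\<close>.\<close>
  moreover have "(2::nat) ^ n \<le> 2 ^ (Suc a + (n - Suc a))" by (intro power_increasing) auto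
  ultimately show "2 ^ n \<le> 2 ^ Suc a * weight h n F" by (simp only: power_add)
qed

section \<open>Membership in \<open>\<Sigma>\<^sup>0\<^sub>2\<close>\<close>

text \<open>\<open>hausdorff_zero\<close> and \<open>hausdorff_pos\<close> are the two directions.
  The universally quantified \<open>y\<close> codes a length \<open>n\<close> together with a finite
  set, given as the support of a coded sequence.\<close>

lemma Sigma02_hausdorff_pos:
  assumes "cf h"
  shows "Sigma02 {e. 0 < hausdorff_cantor s (paths (rtree e))}"
proof -
  define R where "R e c y \<longleftrightarrow> (cover_at e (pfst y) {i. rd (psnd y) i \<noteq> 0} \<longrightarrow>
    2 ^ pfst y \<le> 2 ^ c * weight h (pfst y) {i. rd (psnd y) i \<noteq> 0})" for e c y
  have "dec (\<lambda>z. R (pfst z) (pfst (psnd z)) (psnd (psnd z)))"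
    unfolding R_def cover_at_def weight_def mem_Collect_eq by (intro cf_intros cf_comp[OF assms])
  then have "decidable3 R" by (rule decidable3_dec)
  moreover have "0 < hausdorff_cantor s (paths (rtree e)) \<longleftrightarrow> (\<exists>c. \<forall>y. R e c y)" for e
  proof
    assume "0 < hausdorff_cantor s (paths (rtree e))"
    then obtain c where c: "\<And>n F. cover_at e n F \<Longrightarrow> 2 ^ n \<le> 2 ^ c * weight h n F"
      using hausdorff_zero[of e] by (metis less_irrefl not_le)
    then show "\<exists>c. \<forall>y. R e c y" unfolding R_def by blast
  next
    assume "\<exists>c. \<forall>y. R e c y"
    then obtain c where c: "\<And>y. R e c y" by blast
    show "0 < hausdorff_cantor s (paths (rtree e))"
    proof (rule hausdorff_pos[of _ c])
      fix n F assume "finite F" "cover_at e n F"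
      obtain y where "\<forall>i. rd y i \<noteq> 0 \<longleftrightarrow> i \<in> F" using ex_rd[OF \<open>finite F\<close>] by blast
      then have "{i. rd y i \<noteq> 0} = F" by auto
      then show "2 ^ n \<le> 2 ^ c * weight h n F"
        using c[of "prod_encode (n, y)"] \<open>cover_at e n F\<close> by (simp add: R_def)
    qed
  qed
  ultimately show ?thesis
    unfolding Sigma02_def by (intro exI[of _ R]) simp
qed

section \<open>Hardness for \<open>\<Sigma>\<^sup>0\<^sub>2\<close>\<close>

lemma many_one_reducible_hausdorff_pos:
  assumes "Sigma02 B"
  shows "many_one_reducible B {e. 0 < hausdorff_cantor s (paths (rtree e))}"
proof -
  obtain R where dec_R: "dec (\<lambda>z. R (pfst z) (pfst (psnd z)) (psnd (psnd z)))"
    and B: "\<And>n. n \<in> B \<longleftrightarrow> (\<exists>x. \<forall>y. R n x y)"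
    using Sigma02_dec[OF assms] by blast
  have dec_R': "dec (\<lambda>x. R (f x) (g x) (h x))" if "cf f" "cf g" "cf h" for f g h
    using dec_comp[OF dec_R cf_pair[OF that(1) cf_pair[OF that(2,3)]]] by simp
  \<comment> \<open>\<open>Suc j = 2 ^ k + z\<close> with \<open>z < 2 ^ k\<close> decodes
    \<open>j\<close> as a string of length \<open>k\<close>; the bounds \<open>Suc j\<close> keep
    this search finite. The string is removed if it begins with \<open>x\<close> zeros and a one and
    is longer than some \<open>y\<close> refuting \<open>R n x\<close>.\<close>
  define P where "P n j \<longleftrightarrow> (\<exists>k<Suc j. \<exists>z<Suc j. \<exists>x<k. \<exists>y<k.
    Suc j = 2 ^ k + z \<and> z < 2 ^ k \<and> z mod 2 ^ Suc x = 2 ^ x \<and> \<not> R n x y)" for n j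
  have "dec (\<lambda>z. P (pfst z) (psnd z))"
    unfolding P_def by (intro cf_intros dec_R')
  from semidecider[OF this] obtain f where f: "computable f"
    "\<And>n j. (\<exists>t. conv_within (f n) t j) \<longleftrightarrow> P n j" by blast
  have P_iff: "P n (pcode p k) \<longleftrightarrow> (\<exists>x<k. \<exists>y<k. (\<forall>i\<le>x. p i = (i = x)) \<and> \<not> R n x y)" for n p k
  proof
    assume "P n (pcode p k)"
    then obtain l z x y where *: "x < l" "y < l" "Suc (pcode p k) = 2 ^ l + z" "z < 2 ^ l"
      "z mod 2 ^ Suc x = 2 ^ x" "\<not> R n x y"
      unfolding P_def by blast
    then have eq: "pcode p k = pcode (bit z) l" by (simp add: pcode_bit)
    from pcode_eqD(1)[OF eq] have l: "l = k" by simp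
    have "p i = (i = x)" if "i \<le> x" for i
      using pcode_eqD(2)[OF eq, of i] *(1,5) that unfolding l mod_eq_exp_iff by simp
    then show "\<exists>x<k. \<exists>y<k. (\<forall>i\<le>x. p i = (i = x)) \<and> \<not> R n x y"
      using * l by blast
  next
    assume "\<exists>x<k. \<exists>y<k. (\<forall>i\<le>x. p i = (i = x)) \<and> \<not> R n x y"
    then obtain x y where *: "x < k" "y < k" "\<And>i. i \<le> x \<Longrightarrow> p i = (i = x)" "\<not> R n x y"
      by blast
    obtain z :: nat where z: "z < 2 ^ k" "pcode p k = pcode (bit z) k"
      using ex_bits[of k p] by blast
    have "bit z i = (i = x)" if "i \<le> x" for i
      using pcode_eqD(2)[OF z(2), of i] *(1,3) that by simp
    then have "z mod 2 ^ Suc x = 2 ^ x" by (simp only: mod_eq_exp_iff) simp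
    moreover have "Suc (pcode p k) = 2 ^ k + z" using z by (simp add: pcode_bit)
    moreover from this have "k < Suc (pcode p k)" "z < Suc (pcode p k)"
      using less_exp[of k] z(1) by linarith+
    ultimately show "P n (pcode p k)"
      using z(1) * unfolding P_def by blast
  qed
  have paths: "p \<in> paths (rtree (f n)) \<longleftrightarrow> (\<forall>k. \<not> P n (pcode p k))" for p n
    using f(2) unfolding mem_paths_rtree by blast
  have "n \<in> B \<longleftrightarrow> 0 < hausdorff_cantor s (paths (rtree (f n)))" for n
  proof
    assume "n \<in> B"
    then obtain x where x: "\<And>y. R n x y" using B by blast
    show "0 < hausdorff_cantor s (paths (rtree (f n)))"
    proof (rule hausdorff_pos_cylinder)
      fix p assume p: "\<And>i. i \<le> x \<Longrightarrow> p i = (i = x)"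
      \<comment> \<open>A sequence has only one first one, so no other \<open>x'\<close> can remove
        a prefix of \<open>p\<close>.\<close>
      have "x' = x" if "\<forall>i\<le>x'. p i = (i = x')" for x'
        using that p[of x'] p[of x] by (cases "x \<le> x'") auto
      then show "p \<in> paths (rtree (f n))"
        using x unfolding paths P_iff by blast
    qed
  next
    assume pos: "0 < hausdorff_cantor s (paths (rtree (f n)))"
    show "n \<in> B"
    proof (rule ccontr)
      assume "n \<notin> B"
      have "paths (rtree (f n)) \<subseteq> {\<lambda>_. False}"
      proof (rule ccontr)
        assume "\<not> ?thesis"
        then obtain p j where p: "p \<in> paths (rtree (f n))" "p j" by auto
        define x where "x = (LEAST i. p i)"
        have "p x" unfolding x_def using p(2) by (rule LeastI)
        moreover have "\<not> p i" if "i < x" for i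
          using that unfolding x_def by (rule not_less_Least)
        ultimately have px: "\<forall>i\<le>x. p i = (i = x)"
          by (simp add: le_less)
        obtain y where y: "\<not> R n x y" using \<open>n \<notin> B\<close> B by blast
        \<comment> \<open>A prefix of this length shows the first one at \<open>x\<close> and is
          long enough for the refuting \<open>y\<close> to count.\<close>
        have "x < Suc (max x y)" "y < Suc (max x y)" by auto
        then have "P n (pcode p (Suc (max x y)))"
          using px y unfolding P_iff by blast
        then show False using p(1) unfolding paths by blast
      qed
      then have "hausdorff_cantor s (paths (rtree (f n))) = 0"
        by (rule hausdorff_zero_singleton)
      with pos show False by simp
    qed
  qed
  then show ?thesis
    using f(1) unfolding many_one_reducible_def by blast
qed

end

theorem mainTheorem7:
  fixes s :: real
  assumes "s \<in> \<rat>" and "0 < s" and "s < 1"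
  shows "Sigma02_complete {e. hausdorff_cantor s (paths (rtree e)) > 0}"
proof -
  obtain p q :: nat where pq: "q \<noteq> 0" "\<bar>s\<bar> = p / q"
    using Rats_abs_nat_div_natE[OF assms(1)] by metis
  \<comment> \<open>\<open>p * k div q\<close> is the floor of \<open>s * k\<close>, computed within
    the natural numbers.\<close>
  interpret dimension s "\<lambda>k. p * k div q"
  proof
    have s: "s = p / q" using pq assms(2) by simp
    show "real (p * k div q) \<le> s * k" for k
      using of_nat_div_le_of_nat[of "p * k" q, where ?'a = real] by (simp add: s)
    show "s * k \<le> real (p * k div q) + 1" for k
    proof -
      have "real (p * k mod q) / q \<le> 1"
        using pq(1) by (simp add: divide_le_eq_1 less_imp_le)
      then show ?thesis
        using of_nat_of_nat_div_aux[of "p * k" q, where ?'a = real] by (simp add: s)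
    qed
  qed (use assms in auto)
  have "cf (\<lambda>k. p * k div q)" by (intro cf_intros)
  then show ?thesis
    unfolding Sigma02_complete_def
    using Sigma02_hausdorff_pos many_one_reducible_hausdorff_pos by blast
qed

end
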